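(* Let $G$ be a prime $(P_6,\text{bull})$-free graph on $n$ vertices, and let $x$ be any vertex of $G$. Suppose that there is a $5$-cycle induced by non-neighbors of $x$ (i.e. five vertices, all distinct from and non-adjacent to $x$, that induce a $5$-cycle in $G$). Then there is a clique $F$ (possibly empty) in $G$ such that the induced subgraph $G\setminus F$ is triangle-free, and such a set $F$ can be found in time $O(n^2)$.
   Context: Graphs are finite and simple. A graph $G$ contains a graph $F$ if $F$ is isomorphic to an induced subgraph of $G$; $G$ is $F$-free if it does not contain $F$, and $(P_6,\text{bull})$-free if it is both $P_6$-free and bull-free. $P_6$ is the path on six vertices. The bull is the graph with five vertices $a,b,c,d,e$ and edges $ab,bc,cd,be,ce$. A homogeneous set in $G$ is a set $S\subseteq V(G)$ such that every vertex of $V(G)\setminus S$ is either adjacent to all vertices of $S$ or adjacent to none of them; it is proper if $|S|\ge 2$ and $S\neq V(G)$. A graph is prime if it has no proper homogeneous set. A triangle is a complete graph on three vertices. $G\setminus F$ denotes the subgraph of $G$ induced by $V(G)\setminus F$. *)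

theory Defs
  imports Main
begin

section \<open>Graphs\<close>

record 'a graph =
  verts :: "'a set"
  adj :: "'a \<Rightarrow> 'a \<Rightarrow> bool"

definition simple_graph :: "'a graph \<Rightarrow> bool" where
  "simple_graph G \<longleftrightarrow> finite (verts G) \<and>
    (\<forall>u v. adj G u v \<longrightarrow> u \<in> verts G \<and> v \<in> verts G \<and> u \<noteq> v \<and> adj G v u)"

definition induced :: "'a graph \<Rightarrow> 'a set \<Rightarrow> 'a graph" where
  "induced G S = \<lparr>verts = verts G \<inter> S, adj = (\<lambda>u v. u \<in> S \<and> v \<in> S \<and> adj G u v)\<rparr>"

definition delete_verts :: "'a graph \<Rightarrow> 'a set \<Rightarrow> 'a graph" where
  "delete_verts G F = induced G (verts G - F)"

definition isomorphic :: "'a graph \<Rightarrow> 'b graph \<Rightarrow> bool" where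
  "isomorphic G H \<longleftrightarrow> (\<exists>f. bij_betw f (verts G) (verts H) \<and>
    (\<forall>u\<in>verts G. \<forall>v\<in>verts G. adj G u v \<longleftrightarrow> adj H (f u) (f v)))"

definition contains :: "'a graph \<Rightarrow> 'b graph \<Rightarrow> bool" where
  "contains G F \<longleftrightarrow> (\<exists>S\<subseteq>verts G. isomorphic F (induced G S))"

abbreviation free_of :: "'a graph \<Rightarrow> 'b graph \<Rightarrow> bool" where
  "free_of G F \<equiv> \<not> contains G F"

definition graph_of_edges :: "nat \<Rightarrow> nat set set \<Rightarrow> nat graph" where
  "graph_of_edges k D = \<lparr>verts = {..<k}, adj = (\<lambda>u v. {u, v} \<in> D)\<rparr>"

definition P6 :: "nat graph" where
  "P6 = graph_of_edges 6 {{0,1}, {1,2}, {2,3}, {3,4}, {4,5}}"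

definition C5 :: "nat graph" where
  "C5 = graph_of_edges 5 {{0,1}, {1,2}, {2,3}, {3,4}, {4,0}}"

definition triangle :: "nat graph" where
  "triangle = graph_of_edges 3 {{0,1}, {1,2}, {0,2}}"

text \<open>The vertices \<open>a, b, c, d, e\<close> of the bull are numbered \<open>0, 1, 2, 3, 4\<close>.\<close>

definition bull :: "nat graph" where
  "bull = graph_of_edges 5 {{0,1}, {1,2}, {2,3}, {1,4}, {2,4}}"

definition homogeneous :: "'a graph \<Rightarrow> 'a set \<Rightarrow> bool" where
  "homogeneous G S \<longleftrightarrow> S \<subseteq> verts G \<and>
    (\<forall>v\<in>verts G - S. (\<forall>s\<in>S. adj G v s) \<or> (\<forall>s\<in>S. \<not> adj G v s))"

definition proper_homogeneous :: "'a graph \<Rightarrow> 'a set \<Rightarrow> bool" where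
  "proper_homogeneous G S \<longleftrightarrow> homogeneous G S \<and> 2 \<le> card S \<and> S \<noteq> verts G"

definition prime_graph :: "'a graph \<Rightarrow> bool" where
  "prime_graph G \<longleftrightarrow> (\<nexists>S. proper_homogeneous G S)"

definition clique :: "'a graph \<Rightarrow> 'a set \<Rightarrow> bool" where
  "clique G F \<longleftrightarrow> F \<subseteq> verts G \<and> (\<forall>u\<in>F. \<forall>v\<in>F. u \<noteq> v \<longrightarrow> adj G u v)"

definition five_cycle_avoiding :: "'a graph \<Rightarrow> 'a \<Rightarrow> bool" where
  "five_cycle_avoiding G x \<longleftrightarrow>
    (\<exists>C\<subseteq>verts G. (\<forall>c\<in>C. c \<noteq> x \<and> \<not> adj G x c) \<and> isomorphic C5 (induced G C))"


section \<open>A unit-cost random access machine for graph algorithms\<close>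

text \<open>
  Programs work on natural numbers, with finitely many scalar variables, arrays (both initially
  zero), and read-only access to the adjacency matrix of the input graph.  Every elementary
  operation, including an array access and an adjacency query, costs one unit.  The only
  arithmetic operations are successor and predecessor, so a number occurring after \<open>t\<close> units of
  time exceeds the input size by at most \<open>t\<close> plus a constant depending on the program; hence
  in polynomial time all values fit into \<open>O(log n)\<close> bits and the unit-cost measure does not hide
  any computation on large numbers.
\<close>

datatype expr =
    Lit nat
  | Scalar nat
  | Cell nat expr
  | Succ expr
  | Pred expr
  | Less expr expr
  | Equal expr expr
  | Adjacent expr expr

datatype com =
    Skip
  | Assign nat expr
  | Store nat expr expr
  | Seq com com
  | If expr com com
  | While expr com

record state =
  scalar :: "nat \<Rightarrow> nat"
  cell :: "nat \<Rightarrow> nat \<Rightarrow> nat"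

primrec expr_val :: "(nat \<Rightarrow> nat \<Rightarrow> bool) \<Rightarrow> state \<Rightarrow> expr \<Rightarrow> nat" where
  "expr_val A s (Lit k) = k"
| "expr_val A s (Scalar v) = scalar s v"
| "expr_val A s (Cell a e) = cell s a (expr_val A s e)"
| "expr_val A s (Succ e) = Suc (expr_val A s e)"
| "expr_val A s (Pred e) = expr_val A s e - 1"
| "expr_val A s (Less e f) = of_bool (expr_val A s e < expr_val A s f)"
| "expr_val A s (Equal e f) = of_bool (expr_val A s e = expr_val A s f)"
| "expr_val A s (Adjacent e f) = of_bool (A (expr_val A s e) (expr_val A s f))"

primrec expr_cost :: "expr \<Rightarrow> nat" where
  "expr_cost (Lit k) = 1"
| "expr_cost (Scalar v) = 1"
| "expr_cost (Cell a e) = 1 + expr_cost e"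
| "expr_cost (Succ e) = 1 + expr_cost e"
| "expr_cost (Pred e) = 1 + expr_cost e"
| "expr_cost (Less e f) = 1 + expr_cost e + expr_cost f"
| "expr_cost (Equal e f) = 1 + expr_cost e + expr_cost f"
| "expr_cost (Adjacent e f) = 1 + expr_cost e + expr_cost f"

text \<open>
  \<open>exec A p s t s'\<close>: started in \<open>s\<close> with adjacency matrix \<open>A\<close>, the program \<open>p\<close> terminates in \<open>s'\<close>
  after exactly \<open>t\<close> units of time.  A condition counts as true iff its value is nonzero.
\<close>

inductive exec :: "(nat \<Rightarrow> nat \<Rightarrow> bool) \<Rightarrow> com \<Rightarrow> state \<Rightarrow> nat \<Rightarrow> state \<Rightarrow> bool"
  for A :: "nat \<Rightarrow> nat \<Rightarrow> bool" where
  exec_Skip: "exec A Skip s 1 s"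
| exec_Assign:
    "exec A (Assign v e) s (1 + expr_cost e) (s\<lparr>scalar := (scalar s)(v := expr_val A s e)\<rparr>)"
| exec_Store:
    "exec A (Store a e f) s (1 + expr_cost e + expr_cost f)
      (s\<lparr>cell := (cell s)(a := (cell s a)(expr_val A s e := expr_val A s f))\<rparr>)"
| exec_Seq: "exec A p s t s' \<Longrightarrow> exec A q s' t' s'' \<Longrightarrow> exec A (Seq p q) s (t + t') s''"
| exec_If_true:
    "expr_val A s e \<noteq> 0 \<Longrightarrow> exec A p s t s' \<Longrightarrow> exec A (If e p q) s (1 + expr_cost e + t) s'"
| exec_If_false:
    "expr_val A s e = 0 \<Longrightarrow> exec A q s t s' \<Longrightarrow> exec A (If e p q) s (1 + expr_cost e + t) s'"
| exec_While_false:
    "expr_val A s e = 0 \<Longrightarrow> exec A (While e p) s (1 + expr_cost e) s"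
| exec_While_true:
    "expr_val A s e \<noteq> 0 \<Longrightarrow> exec A p s t s' \<Longrightarrow> exec A (While e p) s' t' s'' \<Longrightarrow>
     exec A (While e p) s (1 + expr_cost e + t + t') s''"

text \<open>
  A numbering \<open>num\<close> of the vertices of \<open>G\<close> by \<open>0, \<dots>, n - 1\<close> turns \<open>G\<close> into an input of the machine.
  Scalar 0 initially holds the number of vertices and scalar 1 the number of the given vertex.
\<close>

definition adj_matrix :: "'a graph \<Rightarrow> (nat \<Rightarrow> 'a) \<Rightarrow> nat \<Rightarrow> nat \<Rightarrow> bool" where
  "adj_matrix G num i j \<longleftrightarrow>
    i < card (verts G) \<and> j < card (verts G) \<and> adj G (num i) (num j)"

definition input_state :: "nat \<Rightarrow> nat \<Rightarrow> state" where
  "input_state n i = \<lparr>scalar = (\<lambda>_. 0)(0 := n, 1 := i), cell = (\<lambda>_ _. 0)\<rparr>"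

text \<open>The result of a run is the set whose characteristic vector is stored in array 0.\<close>

definition output_set :: "nat \<Rightarrow> (nat \<Rightarrow> 'a) \<Rightarrow> state \<Rightarrow> 'a set" where
  "output_set n num s = num ` {i. i < n \<and> cell s 0 i \<noteq> 0}"

end

theory Submission
  imports Defs
begin

text \<open>Let \<open>C\<close> be an induced 5-cycle. Call a vertex anticomplete to \<open>C\<close> an anticentre and a vertex
  complete to \<open>C\<close> a centre. If \<open>D\<close> is a nonempty set of vertices and \<open>S\<close> is a connected set
  anticomplete to \<open>D\<close>, then in a prime bull-free graph some vertex outside \<open>D\<close> has a neighbour in
  \<open>D\<close> and misses a vertex of \<open>S\<close>. Applied to the anticentres and to \<open>C\<close>, this gives an anticentre
  \<open>z\<close> with a neighbour \<open>y\<close> that is a twin of some vertex \<open>c0\<close> of \<open>C\<close>. The bull is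
  self-complementary, so the same statement in the complement excludes centres. Hence every vertex
  is an anticentre, or has one neighbour on \<open>C\<close>, or two neighbours at distance two, or four
  neighbours; in the last case it misses \<open>c0\<close>. The vertices with four neighbours form a clique,
  and bulls and \<open>P6\<close>s show that no triangle avoids it.

  To find this clique without knowing \<open>C\<close>, take a neighbour \<open>y\<close> of the given vertex \<open>x\<close>; it plays
  the above role. For every non-neighbour \<open>u\<close> of \<open>y\<close> that shares a neighbour with \<open>y\<close>, choose a common
  neighbour \<open>r u\<close>. An edge \<open>uv\<close> between such vertices meets the clique iff \<open>r u\<close> is adjacent to \<open>v\<close> or \<open>r v\<close>
  to \<open>u\<close>, and the clique consists of the vertices all of whose edges (at least one) are of this
  kind.\<close>

section \<open>Prime bull-free graphs\<close>

text \<open>The ten conditions of \<open>no_bull\<close> force the five vertices to be distinct, so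
  they describe exactly an induced bull, with triangle \<open>b c e\<close> and pendant vertices
  \<open>a\<close> at \<open>b\<close> and \<open>d\<close> at \<open>c\<close>.\<close>

locale prime_bull_free =
  fixes V :: "'a set" and E :: "'a \<Rightarrow> 'a \<Rightarrow> bool"
  assumes fin: "finite V"
    and dom: "E u v \<Longrightarrow> u \<in> V"
    and sym: "E u v \<Longrightarrow> E v u"
    and irrefl: "\<not> E u u"
    and prime: "S \<subseteq> V \<Longrightarrow> 2 \<le> card S \<Longrightarrow> S \<noteq> V \<Longrightarrow>
      \<exists>w\<in>V - S. \<exists>s\<in>S. \<exists>t\<in>S. E w s \<and> \<not> E w t"
    and no_bull: "E a b \<Longrightarrow> E b c \<Longrightarrow> E c d \<Longrightarrow> E b e \<Longrightarrow> E c e \<Longrightarrow>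
      \<not> E a c \<Longrightarrow> \<not> E a d \<Longrightarrow> \<not> E a e \<Longrightarrow> \<not> E b d \<Longrightarrow> \<not> E d e \<Longrightarrow> False"
begin

lemma sym_iff: "E u v \<longleftrightarrow> E v u"
  using sym by blast

section \<open>Connected sets and vertices mixed on them\<close>

text \<open>Connectedness is expressed by cuts because the cut needed later separates the neighbours
  of a vertex \<open>w\<close> in \<open>S\<close> from its non-neighbours.\<close>

definition conn :: "'a set \<Rightarrow> bool" where
  "conn S \<longleftrightarrow> (\<forall>A\<subseteq>S. A \<noteq> {} \<and> A \<noteq> S \<longrightarrow> (\<exists>a\<in>A. \<exists>b\<in>S - A. E a b))"

lemma conn_mixed:
  assumes "conn S" "s \<in> S" "t \<in> S" "E w s" "\<not> E w t"
  obtains a b where "a \<in> S" "b \<in> S" "E a b" "E w a" "\<not> E w b"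
proof -
  have "\<exists>a\<in>{s \<in> S. E w s}. \<exists>b\<in>S - {s \<in> S. E w s}. E a b"
    using assms(1) assms(2-5) unfolding conn_def by (elim allE[of _ "{s \<in> S. E w s}"]) auto
  then show thesis using that by blast
qed

lemma conn_insert:
  assumes "conn S" "s \<in> S" "E w s"
  shows "conn (insert w S)"
  unfolding conn_def
proof (intro allI impI)
  fix A assume A: "A \<subseteq> insert w S" "A \<noteq> {} \<and> A \<noteq> insert w S"
  show "\<exists>a\<in>A. \<exists>b\<in>insert w S - A. E a b"
  proof (cases "A \<inter> S = {} \<or> S \<subseteq> A")
    case True
    moreover have "E s w" using assms(3) by (rule sym)
    moreover have "A = {w} \<or> A = S" if "A \<inter> S = {} \<or> S \<subseteq> A"
      using A that by blast
    ultimately show ?thesis using A assms(2,3) by blast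
  next
    case False
    then have "\<exists>a\<in>A \<inter> S. \<exists>b\<in>S - A \<inter> S. E a b"
      using assms(1) unfolding conn_def by (elim allE[of _ "A \<inter> S"]) auto
    then show ?thesis by blast
  qed
qed

lemma conn_edge: "E a b \<Longrightarrow> conn {a, b}"
  using conn_insert[of "{b}" b a] by (simp add: conn_def subset_singleton_iff)

lemma card_edge: "E a b \<Longrightarrow> 2 \<le> card {a, b}"
  using irrefl by (cases "a = b") auto

lemma finite_maximal:
  assumes "P S" "\<And>S. P S \<Longrightarrow> S \<subseteq> V"
  shows "\<exists>M. P M \<and> S \<subseteq> M \<and> (\<forall>w. w \<notin> M \<longrightarrow> \<not> P (insert w M))"
proof -
  have "finite {S. P S}"
    using fin assms(2) by (metis (no_types, lifting) Collect_mono Pow_def finite_Pow_iff finite_subset)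
  then obtain M where M: "M \<in> {S. P S}" "S \<subseteq> M" "\<forall>T\<in>{S. P S}. M \<subseteq> T \<longrightarrow> M = T"
    using finite_has_maximal2[of "{S. P S}" S] assms(1) by auto
  then show ?thesis by blast
qed

text \<open>Take a maximal connected \<open>M\<close> inside \<open>P\<close> that contains the
  edge. As \<open>M\<close> is not homogeneous, some \<open>w\<close> is mixed on it, and
  \<open>w \<in> P\<close> would allow \<open>M\<close> to grow. Later this reduces the stability of
  a class of vertices to the study of one outside vertex.\<close>

lemma mixed_on_edge_outside:
  assumes "E a b" "a \<in> P" "b \<in> P" "P \<subset> V"
  obtains a' b' w where "a' \<in> P" "b' \<in> P" "E a' b'" "w \<notin> P" "E w a'" "\<not> E w b'"
proof -
  have "\<exists>M. (M \<subseteq> P \<and> conn M) \<and> {a, b} \<subseteq> M \<and>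
      (\<forall>w. w \<notin> M \<longrightarrow> \<not> (insert w M \<subseteq> P \<and> conn (insert w M)))"
    using assms conn_edge[of a b] by (intro finite_maximal) auto
  then obtain M where MP: "M \<subseteq> P" and Mc: "conn M" and abM: "{a, b} \<subseteq> M"
    and max: "\<forall>w. w \<notin> M \<longrightarrow> \<not> (insert w M \<subseteq> P \<and> conn (insert w M))"
    by blast
  have MV: "M \<subseteq> V" "M \<noteq> V" using MP assms(4) by blast+
  have "2 \<le> card M"
    using card_edge[OF assms(1)] card_mono[OF finite_subset[OF MV(1) fin] abM] by linarith
  then obtain w s t where w: "w \<in> V - M" "s \<in> M" "t \<in> M" "E w s" "\<not> E w t"
    using prime[OF MV(1) _ MV(2)] by blast
  then have "w \<notin> P" using max MP conn_insert[OF Mc w(2,4)] by blast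
  moreover obtain c d where "c \<in> M" "d \<in> M" "E c d" "E w c" "\<not> E w d"
    using conn_mixed[OF Mc w(2-5)] by blast
  ultimately show thesis using that MP by blast
qed

text \<open>Suppose every \<open>v\<close> with a neighbour \<open>d \<in> D\<close> is complete to a connected set \<open>M\<close>, and \<open>w\<close> is
  mixed on an edge of \<open>M\<close>. If \<open>v\<close> missed \<open>w\<close>, then \<open>w\<close>, \<open>v\<close>, \<open>d\<close> and that edge would form a
  bull; so \<open>M\<close> can be enlarged by \<open>w\<close>, and a maximal \<open>M\<close> is homogeneous.\<close>

lemma attachment_not_complete:
  assumes D: "D \<subseteq> V" "D \<noteq> {}" and S: "S \<subseteq> V" "2 \<le> card S" "conn S"
    and DS: "\<And>d s. d \<in> D \<Longrightarrow> s \<in> S \<Longrightarrow> \<not> E d s" "S \<inter> D = {}"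
  shows "\<exists>v d s. v \<notin> D \<and> d \<in> D \<and> E v d \<and> s \<in> S \<and> \<not> E v s"
proof (rule ccontr)
  assume K: "\<not> ?thesis"
  define P where "P S \<longleftrightarrow> S \<subseteq> V \<and> conn S \<and> S \<inter> D = {} \<and> (\<forall>d\<in>D. \<forall>s\<in>S. \<not> E d s) \<and>
    (\<forall>v d s. v \<notin> D \<and> d \<in> D \<and> E v d \<and> s \<in> S \<longrightarrow> E v s)" for S
  have "P S" unfolding P_def using S DS K by auto
  moreover have "T \<subseteq> V" if "P T" for T using that unfolding P_def by blast
  ultimately obtain M where M: "P M" "S \<subseteq> M" "\<And>w. w \<notin> M \<Longrightarrow> \<not> P (insert w M)"
    using finite_maximal[of P S] by metis
  from M(1) have MV: "M \<subseteq> V" and Mc: "conn M" and MD: "M \<inter> D = {}"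
    and DM: "\<And>d s. d \<in> D \<Longrightarrow> s \<in> M \<Longrightarrow> \<not> E d s"
    and KM: "\<And>v d s. v \<notin> D \<Longrightarrow> d \<in> D \<Longrightarrow> E v d \<Longrightarrow> s \<in> M \<Longrightarrow> E v s"
    unfolding P_def by blast+
  have "2 \<le> card M"
    using S(2) card_mono[OF finite_subset[OF MV fin] M(2)] by linarith
  moreover have "M \<noteq> V" using MD D by blast
  ultimately obtain w s t where w: "w \<in> V - M" "s \<in> M" "t \<in> M" "E w s" "\<not> E w t"
    using prime[OF MV] by blast
  have "w \<notin> D" using DM w by blast
  moreover have wD: "\<not> E w d" if "d \<in> D" for d
    using KM[OF \<open>w \<notin> D\<close> that] w by blast
  obtain a b where ab: "a \<in> M" "b \<in> M" "E a b" "E w a" "\<not> E w b"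
    using conn_mixed[OF Mc w(2-5)] by blast
  have "E v w" if v: "v \<notin> D" "d \<in> D" "E v d" for v d
  proof (rule ccontr)
    assume "\<not> E v w"
    then show False
      using no_bull[of w a v d b] ab v(3) KM[OF v ab(1)] KM[OF v ab(2)] DM[OF v(2) ab(1)]
        DM[OF v(2) ab(2)] wD[OF v(2)] sym_iff by metis
  qed
  moreover have "\<not> E d w" if "d \<in> D" for d using wD[OF that] sym by blast
  ultimately have "P (insert w M)"
    unfolding P_def using MV MD DM KM w(1) \<open>w \<notin> D\<close> conn_insert[OF Mc w(2,4)] by blast
  then show False using M(3) w(1) by blast
qed

section \<open>Complementation\<close>

definition co :: "'a \<Rightarrow> 'a \<Rightarrow> bool" where
  "co u v \<longleftrightarrow> u \<in> V \<and> v \<in> V \<and> u \<noteq> v \<and> \<not> E u v"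

text \<open>Homogeneous sets are the same in the complement, and the bull is
  self-complementary.\<close>

lemma prime_bull_free_co: "prime_bull_free V co"
proof
  show "co u v \<Longrightarrow> co v u" for u v using sym unfolding co_def by blast
  show "\<exists>w\<in>V - S. \<exists>s\<in>S. \<exists>t\<in>S. co w s \<and> \<not> co w t"
    if "S \<subseteq> V" "2 \<le> card S" "S \<noteq> V" for S
    using prime[OF that] that(1) unfolding co_def by blast
  show False
    if "co a b" "co b c" "co c d" "co b e" "co c e"
      "\<not> co a c" "\<not> co a d" "\<not> co a e" "\<not> co b d" "\<not> co d e" for a b c d e
  proof -
    have "a \<noteq> c" "a \<noteq> d" "a \<noteq> e" "b \<noteq> d" "d \<noteq> e" using that unfolding co_def by (metis sym)+
    \<comment> \<open>The complementary bull has triangle \<open>d a e\<close> and pendant vertices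
      \<open>b\<close> at \<open>d\<close> and \<open>c\<close> at \<open>a\<close>.\<close>
    then show False
      using that no_bull[of b d a c e] unfolding co_def by (metis sym)
  qed
qed (auto simp: fin co_def)

end

section \<open>Five-cycles with an anticentre\<close>

locale prime_P6_bull_free = prime_bull_free +
  assumes no_P6: "E a b \<Longrightarrow> E b c \<Longrightarrow> E c d \<Longrightarrow> E d e \<Longrightarrow> E e f \<Longrightarrow>
    \<not> E a c \<Longrightarrow> \<not> E a d \<Longrightarrow> \<not> E a e \<Longrightarrow> \<not> E a f \<Longrightarrow> \<not> E b d \<Longrightarrow> \<not> E b e \<Longrightarrow> \<not> E b f \<Longrightarrow>
    \<not> E c e \<Longrightarrow> \<not> E c f \<Longrightarrow> \<not> E d f \<Longrightarrow> False"
begin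

section \<open>Labelled 5-cycles and types of vertices\<close>

text \<open>The argument order fixes a labelling, so a lemma proved for one position passes to the
  others through \<open>cyc_rot\<close> and \<open>cyc_flip\<close>.\<close>

definition cyc :: "'a \<Rightarrow> 'a \<Rightarrow> 'a \<Rightarrow> 'a \<Rightarrow> 'a \<Rightarrow> bool" where
  "cyc c0 c1 c2 c3 c4 \<longleftrightarrow> E c0 c1 \<and> E c1 c2 \<and> E c2 c3 \<and> E c3 c4 \<and> E c4 c0 \<and>
    \<not> E c0 c2 \<and> \<not> E c1 c3 \<and> \<not> E c2 c4 \<and> \<not> E c3 c0 \<and> \<not> E c4 c1"

lemma cyc_rot: "cyc c0 c1 c2 c3 c4 \<Longrightarrow> cyc c1 c2 c3 c4 c0"
  unfolding cyc_def by blast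

lemma cyc_flip: "cyc c0 c1 c2 c3 c4 \<Longrightarrow> cyc c0 c4 c3 c2 c1"
  unfolding cyc_def using sym_iff by metis

lemma cycD:
  assumes "cyc c0 c1 c2 c3 c4"
  shows "E c0 c1" "E c1 c2" "E c2 c3" "E c3 c4" "E c4 c0"
    "E c1 c0" "E c2 c1" "E c3 c2" "E c4 c3" "E c0 c4"
    "\<not> E c0 c2" "\<not> E c1 c3" "\<not> E c2 c4" "\<not> E c3 c0" "\<not> E c4 c1"
    "\<not> E c2 c0" "\<not> E c3 c1" "\<not> E c4 c2" "\<not> E c0 c3" "\<not> E c1 c4"
  using assms sym_iff unfolding cyc_def by metis+

text \<open>By \<open>vertex_types\<close> below, \<open>anti\<close> and the rotations of \<open>typA\<close>, \<open>typB\<close>, \<open>typT\<close> are the only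
  possible types of a vertex with respect to a 5-cycle that has an anticentre.\<close>

definition anti :: "'a \<Rightarrow> 'a \<Rightarrow> 'a \<Rightarrow> 'a \<Rightarrow> 'a \<Rightarrow> 'a \<Rightarrow> bool" where
  "anti c0 c1 c2 c3 c4 z \<longleftrightarrow>
    z \<in> V \<and> \<not> E z c0 \<and> \<not> E z c1 \<and> \<not> E z c2 \<and> \<not> E z c3 \<and> \<not> E z c4"

definition center :: "'a \<Rightarrow> 'a \<Rightarrow> 'a \<Rightarrow> 'a \<Rightarrow> 'a \<Rightarrow> 'a \<Rightarrow> bool" where
  "center c0 c1 c2 c3 c4 v \<longleftrightarrow> E v c0 \<and> E v c1 \<and> E v c2 \<and> E v c3 \<and> E v c4"

text \<open>A twin of \<open>c0\<close>: exchanging it with \<open>c0\<close> gives another induced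
  5-cycle.\<close>

definition typA :: "'a \<Rightarrow> 'a \<Rightarrow> 'a \<Rightarrow> 'a \<Rightarrow> 'a \<Rightarrow> 'a \<Rightarrow> bool" where
  "typA c0 c1 c2 c3 c4 v \<longleftrightarrow> \<not> E v c0 \<and> E v c1 \<and> \<not> E v c2 \<and> \<not> E v c3 \<and> E v c4"

definition typB :: "'a \<Rightarrow> 'a \<Rightarrow> 'a \<Rightarrow> 'a \<Rightarrow> 'a \<Rightarrow> 'a \<Rightarrow> bool" where
  "typB c0 c1 c2 c3 c4 v \<longleftrightarrow> E v c0 \<and> \<not> E v c1 \<and> \<not> E v c2 \<and> \<not> E v c3 \<and> \<not> E v c4"

definition typT :: "'a \<Rightarrow> 'a \<Rightarrow> 'a \<Rightarrow> 'a \<Rightarrow> 'a \<Rightarrow> 'a \<Rightarrow> bool" where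
  "typT c0 c1 c2 c3 c4 v \<longleftrightarrow> \<not> E v c0 \<and> E v c1 \<and> E v c2 \<and> E v c3 \<and> E v c4"

lemma anti_rot: "anti c0 c1 c2 c3 c4 z \<Longrightarrow> anti c1 c2 c3 c4 c0 z"
  unfolding anti_def by blast

lemma anti_flip: "anti c0 c1 c2 c3 c4 z \<Longrightarrow> anti c0 c4 c3 c2 c1 z"
  unfolding anti_def by blast

lemma three_neighbours:
  assumes "cyc c0 c1 c2 c3 c4" "E v c0" "E v c1" "\<not> E v c2" "\<not> E v c4"
  shows "\<not> E v c3"
  using no_bull[of c4 c0 c1 c2 v] cycD[OF assms(1)] assms(2-) sym_iff by metis

text \<open>Otherwise the triangle \<open>v c0 c1\<close> with pendants \<open>c4\<close> and
  \<open>c2\<close> is a bull.\<close>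

lemma edge_third_neighbour:
  assumes "cyc c0 c1 c2 c3 c4" "E v c0" "E v c1"
  shows "E v c2 \<or> E v c4"
  using no_bull[of c4 c0 c1 c2 v] cycD[OF assms(1)] assms(2-) sym_iff by metis

text \<open>Otherwise \<open>z v c0 c1 c2 c3\<close> is an induced path on six vertices.\<close>

lemma anti_nbr_1:
  assumes "cyc c0 c1 c2 c3 c4" "anti c0 c1 c2 c3 c4 z" "E v z"
  shows "\<not> typB c0 c1 c2 c3 c4 v"
  using no_P6[of z v c0 c1 c2 c3] cycD[OF assms(1)] assms(2-) sym_iff
  unfolding anti_def typB_def by metis

text \<open>Otherwise the triangle \<open>v c1 c2\<close> with pendants \<open>z\<close> at
  \<open>v\<close> and \<open>c0\<close> at \<open>c1\<close> is a bull. Repeated around the cycle,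
  this turns two consecutive neighbours into five.\<close>

lemma anti_nbr_3_4:
  assumes "cyc c0 c1 c2 c3 c4" "anti c0 c1 c2 c3 c4 z" "E v z" "E v c1" "E v c2" 
  shows "E v c0"
  using no_bull[of z v c1 c0 c2] cycD[OF assms(1)] assms(2-) sym_iff
  unfolding anti_def by metis

text \<open>Two consecutive neighbours make \<open>v\<close> a centre by
  \<open>anti_nbr_3_4\<close>; otherwise at most two vertices of the cycle are seen, and
  \<open>anti_nbr_1\<close> excludes a single one.\<close>

lemma anti_nbr:
  assumes C: "cyc c0 c1 c2 c3 c4" and z: "anti c0 c1 c2 c3 c4 z" and v: "E v z"
  shows "anti c0 c1 c2 c3 c4 v \<or> center c0 c1 c2 c3 c4 v \<or> typA c0 c1 c2 c3 c4 v \<or>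
    typA c1 c2 c3 c4 c0 v \<or> typA c2 c3 c4 c0 c1 v \<or> typA c3 c4 c0 c1 c2 v \<or> typA c4 c0 c1 c2 c3 v"
proof -
  note C1 = cyc_rot[OF C] note C2 = cyc_rot[OF C1] note C3 = cyc_rot[OF C2] note C4 = cyc_rot[OF C3]
  note z1 = anti_rot[OF z] note z2 = anti_rot[OF z1] note z3 = anti_rot[OF z2] note z4 = anti_rot[OF z3]
  note B = anti_nbr_1[OF C z v] anti_nbr_1[OF C1 z1 v] anti_nbr_1[OF C2 z2 v] anti_nbr_1[OF C3 z3 v]
    anti_nbr_1[OF C4 z4 v]
  note T = anti_nbr_3_4[OF C z v] anti_nbr_3_4[OF C1 z1 v] anti_nbr_3_4[OF C2 z2 v]
    anti_nbr_3_4[OF C3 z3 v] anti_nbr_3_4[OF C4 z4 v]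
  note N = edge_third_neighbour[OF C, of v] edge_third_neighbour[OF C1, of v] edge_third_neighbour[OF C2, of v] edge_third_neighbour[OF C3, of v] edge_third_neighbour[OF C4, of v]
  have "v \<in> V" using v dom by blast
  then show ?thesis
    using B T N unfolding anti_def center_def typA_def typB_def by argo
qed

lemma conn_cyc:
  assumes "cyc c0 c1 c2 c3 c4"
  shows "conn {c0, c1, c2, c3, c4}"
proof -
  note E = cycD[OF assms]
  have "conn {c3, c4}" using conn_edge E by blast
  then have "conn {c2, c3, c4}" using conn_insert E by blast
  then have "conn {c1, c2, c3, c4}" using conn_insert E by blast
  then show ?thesis using conn_insert E by blast
qed

lemma cyc_subset: "cyc c0 c1 c2 c3 c4 \<Longrightarrow> {c0, c1, c2, c3, c4} \<subseteq> V"
  using dom unfolding cyc_def by blast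

lemma card_ge_2: "finite S \<Longrightarrow> a \<in> S \<Longrightarrow> b \<in> S \<Longrightarrow> a \<noteq> b \<Longrightarrow> 2 \<le> card S"
  using card_mono[of S "{a, b}"] by auto

lemma card_cyc: "cyc c0 c1 c2 c3 c4 \<Longrightarrow> 2 \<le> card {c0, c1, c2, c3, c4}"
  using irrefl unfolding cyc_def by (intro card_ge_2[of _ c0 c1]) auto

definition attached :: "'a \<Rightarrow> 'a \<Rightarrow> 'a \<Rightarrow> 'a \<Rightarrow> 'a \<Rightarrow> 'a \<Rightarrow> 'a \<Rightarrow> bool" where
  "attached c0 c1 c2 c3 c4 y z \<longleftrightarrow> cyc c0 c1 c2 c3 c4 \<and> typA c0 c1 c2 c3 c4 y \<and>
    anti c0 c1 c2 c3 c4 z \<and> E y z"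

text \<open>\<open>attachment_not_complete\<close>, applied to the set of all anticentres and the
  cycle, yields a vertex that is neither anticentre nor centre; \<open>anti_nbr\<close> leaves only
  twins.\<close>

lemma attached_ex:
  assumes C: "cyc c0 c1 c2 c3 c4" and x: "anti c0 c1 c2 c3 c4 x"
  shows "\<exists>y z. attached c0 c1 c2 c3 c4 y z \<or> attached c1 c2 c3 c4 c0 y z \<or> attached c2 c3 c4 c0 c1 y z \<or>
    attached c3 c4 c0 c1 c2 y z \<or> attached c4 c0 c1 c2 c3 y z"
proof -
  let ?D = "{z. anti c0 c1 c2 c3 c4 z}" and ?C = "{c0, c1, c2, c3, c4}"
  have "\<exists>v d s. v \<notin> ?D \<and> d \<in> ?D \<and> E v d \<and> s \<in> ?C \<and> \<not> E v s"
  proof (rule attachment_not_complete)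
    show "?D \<subseteq> V" unfolding anti_def by blast
    show "?D \<noteq> {}" using x by blast
    show "\<not> E d s" if "d \<in> ?D" "s \<in> ?C" for d s using that unfolding anti_def by blast
    show "?C \<inter> ?D = {}" using cycD[OF C] unfolding anti_def by blast
  qed (use cyc_subset card_cyc conn_cyc C in auto)
  then obtain v z where v: "anti c0 c1 c2 c3 c4 z" "E v z" "\<not> anti c0 c1 c2 c3 c4 v"
    "\<not> center c0 c1 c2 c3 c4 v"
    unfolding center_def by blast
  note C1 = cyc_rot[OF C] note C2 = cyc_rot[OF C1] note C3 = cyc_rot[OF C2] note C4 = cyc_rot[OF C3]
  note z1 = anti_rot[OF v(1)] note z2 = anti_rot[OF z1] note z3 = anti_rot[OF z2] note z4 = anti_rot[OF z3]
  show ?thesis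
    using anti_nbr[OF C v(1,2)] v C C1 C2 C3 C4 z1 z2 z3 z4 unfolding attached_def by metis
qed

section \<open>Exclusion of centres\<close>

text \<open>This is \<open>attachment_not_complete\<close> in the complement, where the cycle is
  again a 5-cycle and \<open>D\<close> is anticomplete to it.\<close>

lemma co_complete_mixed:
  assumes D: "D \<subseteq> V" "D \<noteq> {}" and C: "cyc c0 c1 c2 c3 c4"
    and DC: "\<And>d. d \<in> D \<Longrightarrow> center c0 c1 c2 c3 c4 d"
  obtains v d where "v \<notin> D" "d \<in> D" "\<not> E v d" "\<not> anti c0 c1 c2 c3 c4 v" "v \<in> V"
proof -
  interpret co: prime_bull_free V co by (rule prime_bull_free_co)
  note E = cycD[OF C]
  have "c0 \<noteq> c2" "c0 \<noteq> c3" "c1 \<noteq> c3" "c1 \<noteq> c4" "c2 \<noteq> c4" using E by blast+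
  moreover have "c0 \<in> V" "c1 \<in> V" "c2 \<in> V" "c3 \<in> V" "c4 \<in> V"
    using cyc_subset[OF C] by auto
  \<comment> \<open>The path \<open>c0 c2 c4 c1 c3\<close> of the complementary 5-cycle already
    gives connectedness.\<close>
  ultimately have co: "co c0 c2" "co c2 c4" "co c4 c1" "co c1 c3"
    using E unfolding co_def by auto
  have "co.conn {c1, c3}" using co.conn_edge co by blast
  then have "co.conn {c4, c1, c3}" using co.conn_insert co by blast
  then have "co.conn {c2, c4, c1, c3}" using co.conn_insert co by blast
  then have "co.conn {c0, c2, c4, c1, c3}" using co.conn_insert co by blast
  moreover have "{c0, c2, c4, c1, c3} = {c0, c1, c2, c3, c4}" by blast
  ultimately have cc: "co.conn {c0, c1, c2, c3, c4}" by simp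
  have "\<exists>v d s. v \<notin> D \<and> d \<in> D \<and> co v d \<and> s \<in> {c0, c1, c2, c3, c4} \<and> \<not> co v s"
  proof (rule co.attachment_not_complete)
    show "\<not> co d s" if "d \<in> D" "s \<in> {c0, c1, c2, c3, c4}" for d s
      using DC[OF that(1)] that(2) unfolding co_def center_def by blast
    show "{c0, c1, c2, c3, c4} \<inter> D = {}" using DC E irrefl unfolding center_def by blast
  qed (use D cc cyc_subset[OF C] card_cyc[OF C] in auto)
  then obtain v d s where v: "v \<notin> D" "d \<in> D" "co v d" "s \<in> {c0, c1, c2, c3, c4}" "\<not> co v s"
    by blast
  have "v \<in> V" "s \<in> V" "\<not> E v d" using v(3,4) cyc_subset[OF C] unfolding co_def by auto
  \<comment> \<open>\<open>co v s\<close> also fails for \<open>v = s\<close>, but a vertex of the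
    cycle is adjacent to \<open>d\<close>, against \<open>co v d\<close>.\<close>
  moreover have "E v s"
  proof (cases "v = s")
    case True
    then have "E d v" using DC[OF v(2)] v(4) unfolding center_def by blast
    then show ?thesis using v(3) sym unfolding co_def by blast
  next
    case False
    then show ?thesis using v(5) \<open>v \<in> V\<close> \<open>s \<in> V\<close> unfolding co_def by blast
  qed
  then have "\<not> anti c0 c1 c2 c3 c4 v" using v(4) unfolding anti_def by blast
  ultimately show thesis using v that by blast
qed

text \<open>Otherwise the triangle \<open>c1 d c0\<close> with pendants \<open>y\<close> at
  \<open>c1\<close> and \<open>c3\<close> at \<open>d\<close> is a bull.\<close>

lemma typA_center:
  assumes "cyc c0 c1 c2 c3 c4" "typA c0 c1 c2 c3 c4 y" "center c0 c1 c2 c3 c4 d"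
  shows "E d y"
  using no_bull[of y c1 d c3 c0] cycD[OF assms(1)] assms sym_iff unfolding typA_def center_def by metis

lemma attached_center:
  assumes "attached c0 c1 c2 c3 c4 y z" "center c0 c1 c2 c3 c4 d"
  shows "E d z"
proof -
  have C: "cyc c0 c1 c2 c3 c4" using assms(1) unfolding attached_def by blast
  have "E d y" using typA_center[OF C] assms unfolding attached_def by blast
  then show ?thesis
    using no_bull[of z y d c3 c1] cycD[OF C] assms sym_iff
    unfolding attached_def typA_def center_def anti_def by metis
qed

text \<open>Used with a centre \<open>d\<close>, an anticentre \<open>z\<close> adjacent to
  \<open>d\<close> and a cycle edge \<open>ab\<close>: a vertex missing \<open>d\<close> and
  \<open>z\<close> cannot distinguish \<open>a\<close> from \<open>b\<close>.\<close>

lemma mixed_edge_anti_center: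
  assumes "E d a" "E d b" "E a b" "E d z" "\<not> E z a" "\<not> E z b" "E v a" "\<not> E v b" "\<not> E v z"
  shows "E v d"
  using no_bull[of v a d z b] assms sym_iff by metis

text \<open>Take \<open>v\<close> and \<open>d\<close> from \<open>co_complete_mixed\<close> for the
  set of all centres. If \<open>v\<close> sees \<open>z\<close>, it is a twin and hence sees
  \<open>d\<close>; if not, it is constant along the cycle edges, hence a centre or an
  anticentre.\<close>

lemma attached_no_center:
  assumes "attached c0 c1 c2 c3 c4 y z"
  shows "\<not> center c0 c1 c2 c3 c4 d0"
proof
  assume d0: "center c0 c1 c2 c3 c4 d0"
  have C: "cyc c0 c1 c2 c3 c4" and z: "anti c0 c1 c2 c3 c4 z" using assms unfolding attached_def by blast+
  note E = cycD[OF C]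
  let ?D = "{d. center c0 c1 c2 c3 c4 d}"
  have "?D \<subseteq> V" using dom unfolding center_def by blast
  moreover have "?D \<noteq> {}" using d0 by blast
  ultimately obtain v d where v: "v \<notin> ?D" "d \<in> ?D" "\<not> E v d" "\<not> anti c0 c1 c2 c3 c4 v" "v \<in> V"
    using co_complete_mixed[OF _ _ C, of ?D] by blast
  then have d: "center c0 c1 c2 c3 c4 d" by blast
  have dz: "E d z" by (rule attached_center[OF assms d])
  show False
  proof (cases "E v z")
    case True
    note C1 = cyc_rot[OF C] note C2 = cyc_rot[OF C1] note C3 = cyc_rot[OF C2] note C4 = cyc_rot[OF C3]
    have "center c1 c2 c3 c4 c0 d" "center c2 c3 c4 c0 c1 d" "center c3 c4 c0 c1 c2 d" "center c4 c0 c1 c2 c3 d"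
      using d unfolding center_def by blast+
    then have "E d v"
      using anti_nbr[OF C z True] v typA_center[OF C _ d] typA_center[OF C1] typA_center[OF C2]
        typA_center[OF C3] typA_center[OF C4] by blast
    then show False using v(3) sym by blast
  next
    case False
    have m: "E v a \<longleftrightarrow> E v b" if "E d a" "E d b" "E a b" "\<not> E z a" "\<not> E z b" for a b
      using mixed_edge_anti_center[of d a b z v] mixed_edge_anti_center[of d b a z v] that dz False v(3) sym
      by blast
    have "E v c0 \<longleftrightarrow> E v c1" "E v c1 \<longleftrightarrow> E v c2" "E v c2 \<longleftrightarrow> E v c3" "E v c3 \<longleftrightarrow> E v c4"
      using m d z E unfolding center_def anti_def by blast+
    then show False using v(1,4,5) unfolding center_def anti_def by blast
  qed
qed

lemma no_center:
  assumes "cyc c0 c1 c2 c3 c4" "anti c0 c1 c2 c3 c4 x"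
  shows "\<not> center c0 c1 c2 c3 c4 d"
  using attached_ex[OF assms] attached_no_center unfolding center_def by metis

lemma attached_flip: "attached c0 c1 c2 c3 c4 y z \<Longrightarrow> attached c0 c4 c3 c2 c1 y z"
  unfolding attached_def typA_def using cyc_flip anti_flip by blast

section \<open>Vertices with four neighbours on the cycle\<close>

lemma anti_typT:
  assumes "cyc c0 c1 c2 c3 c4" "anti c0 c1 c2 c3 c4 z" "typT c0 c1 c2 c3 c4 v"
  shows "\<not> E v z"
  using anti_nbr_3_4[OF assms(1,2), of v] assms(3) unfolding typT_def by blast

lemma attached_typT_0:
  assumes "attached c0 c1 c2 c3 c4 y z" "typT c0 c1 c2 c3 c4 v"
  shows "\<not> E v y"
proof -
  have C: "cyc c0 c1 c2 c3 c4" and z: "anti c0 c1 c2 c3 c4 z" using assms(1) unfolding attached_def by blast+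
  show ?thesis
    using no_bull[of z y c1 c0 v] cycD[OF C] anti_typT[OF C z assms(2)] assms sym_iff
    unfolding attached_def typA_def typT_def anti_def by metis
qed

text \<open>If \<open>v\<close> sees \<open>y\<close>, the triangle \<open>y v c4\<close> with
  pendants \<open>z\<close> and \<open>c2\<close> is a bull, and if not, the triangle
  \<open>c4 v c0\<close> with pendants \<open>y\<close> and \<open>c2\<close>. With its analogues
  this leaves \<open>c0\<close> as the only vertex that can be missed.\<close>

lemma attached_typT_1:
  assumes "attached c0 c1 c2 c3 c4 y z"
  shows "\<not> typT c1 c2 c3 c4 c0 v"
proof
  assume v: "typT c1 c2 c3 c4 c0 v"
  have C: "cyc c0 c1 c2 c3 c4" and z: "anti c0 c1 c2 c3 c4 z" using assms(1) unfolding attached_def by blast+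
  have "\<not> E v z" by (rule anti_typT[OF cyc_rot[OF C] anti_rot[OF z] v])
  show False
  proof (cases "E v y")
    case True
    then show False
      using no_bull[of z y v c2 c4] cycD[OF C] \<open>\<not> E v z\<close> assms v sym_iff
      unfolding attached_def typA_def typT_def anti_def by metis
  next
    case False
    then show False
      using no_bull[of y c4 v c2 c0] cycD[OF C] \<open>\<not> E v z\<close> assms v sym_iff
      unfolding attached_def typA_def typT_def anti_def by metis
  qed
qed

lemma attached_typT_2:
  assumes "attached c0 c1 c2 c3 c4 y z"
  shows "\<not> typT c2 c3 c4 c0 c1 v"
proof
  assume v: "typT c2 c3 c4 c0 c1 v"
  have C: "cyc c0 c1 c2 c3 c4" and z: "anti c0 c1 c2 c3 c4 z" using assms(1) unfolding attached_def by blast+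
  have "\<not> E v z" by (rule anti_typT[OF cyc_rot[OF cyc_rot[OF C]] anti_rot[OF anti_rot[OF z]] v])
  show False
  proof (cases "E v y")
    case True
    then show False
      using no_bull[of z y v c3 c1] cycD[OF C] \<open>\<not> E v z\<close> assms v sym_iff
      unfolding attached_def typA_def typT_def anti_def by metis
  next
    case False
    then show False
      using no_bull[of y c1 v c3 c0] cycD[OF C] \<open>\<not> E v z\<close> assms v sym_iff
      unfolding attached_def typA_def typT_def anti_def by metis
  qed
qed

lemma attached_typT_3: "attached c0 c1 c2 c3 c4 y z \<Longrightarrow> \<not> typT c3 c4 c0 c1 c2 v"
  using attached_typT_2[OF attached_flip, of c0 c1 c2 c3 c4 y z v] unfolding typT_def by blast

lemma attached_typT_4: "attached c0 c1 c2 c3 c4 y z \<Longrightarrow> \<not> typT c4 c0 c1 c2 c3 v"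
  using attached_typT_1[OF attached_flip, of c0 c1 c2 c3 c4 y z v] unfolding typT_def by blast

text \<open>Some rotation is attached, and at every position other than \<open>c0\<close> an
  attachment excludes \<open>v\<close>.\<close>

lemma typT_attached_ex:
  assumes "cyc c0 c1 c2 c3 c4" "anti c0 c1 c2 c3 c4 x" "typT c0 c1 c2 c3 c4 v"
  shows "\<exists>y z. attached c0 c1 c2 c3 c4 y z"
  using attached_ex[OF assms(1,2)] attached_typT_1 attached_typT_2 attached_typT_3 attached_typT_4 assms(3) by meson

section \<open>Stability of the set of twins\<close>

lemma twin_edge_anti:
  assumes "cyc c0 c1 c2 c3 c4" "anti c0 c1 c2 c3 c4 z"
    "E a c1" "\<not> E a c2" "E b c1" "\<not> E b c2" "E a b" "E a z"
  shows "E b z"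
  using no_bull[of z a c1 c2 b] cycD[OF assms(1)] assms sym_iff unfolding anti_def by metis

text \<open>A vertex \<open>w\<close> that distinguishes two adjacent twins \<open>a\<close>, \<open>b\<close> of \<open>c0\<close> and is not a twin itself
  would, up to reflection, be adjacent to \<open>a, c1, c2, c3\<close> and miss \<open>c4\<close>; a vertex \<open>y\<close> attached to the cycle
  through \<open>a\<close> then yields a bull.\<close>

lemma twins_mixed_outside:
  assumes C: "cyc c0 c1 c2 c3 c4" and z: "anti c0 c1 c2 c3 c4 z"
    and a: "E a c1" "E a c4" "\<not> E a c2" "\<not> E a c3"
    and b: "E b c1" "E b c4" "\<not> E b c2" "\<not> E b c3"
    and ab: "E a b" and w: "E w a" "\<not> E w b" "E w c1" "E w c2" "E w c3"
  shows False
proof -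
  have Ca: "cyc a c1 c2 c3 c4" and Cb: "cyc b c1 c2 c3 c4"
    using cycD[OF C] a b sym_iff unfolding cyc_def by metis+
  \<comment> \<open>Seeing \<open>z\<close> would by \<open>anti_nbr_3_4\<close> also give
    \<open>w\<close> the neighbours \<open>c0\<close> and \<open>c4\<close>, making it a
    centre.\<close>
  have wz: "\<not> E w z"
    using anti_nbr_3_4[OF C z, of w] no_center[OF C z, of w] w
      anti_nbr_3_4[OF cyc_rot[OF cyc_rot[OF cyc_rot[OF cyc_rot[OF C]]]]
        anti_rot[OF anti_rot[OF anti_rot[OF anti_rot[OF z]]]], of w]
    unfolding center_def by blast
  show False
  proof (cases "E a z")
    case True
    then show False
      using no_bull[of z a w c3 c1] cycD[OF C] a w wz z sym_iff unfolding anti_def by metis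
  next
    case False
    then have bz: "\<not> E b z" using twin_edge_anti[OF C z b(1,3) a(1,3)] ab sym_iff by blast
    have za: "anti a c1 c2 c3 c4 z" using False z sym_iff unfolding anti_def by metis
    \<comment> \<open>The cycle with \<open>a\<close> in place of \<open>c0\<close> still has an
      anticentre, hence no centre, so \<open>w\<close> misses exactly \<open>c4\<close> on
      it.\<close>
    have "\<not> E w c4" using no_center[OF Ca za] w unfolding center_def by blast
    then have T: "typT c4 a c1 c2 c3 w" using w unfolding typT_def by blast
    note Ca4 = cyc_rot[OF cyc_rot[OF cyc_rot[OF cyc_rot[OF Ca]]]]
    note za4 = anti_rot[OF anti_rot[OF anti_rot[OF anti_rot[OF za]]]]
    obtain y z' where y: "attached c4 a c1 c2 c3 y z'" using typT_attached_ex[OF Ca4 za4 T] by blast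
    then have z': "anti c4 a c1 c2 c3 z'" "E y z'" unfolding attached_def by blast+
    have wy: "\<not> E w y" using attached_typT_0[OF y T] .
    have wz': "\<not> E w z'" using anti_typT[OF Ca4 z'(1) T] .
    have bz': "\<not> E b z'"
      using anti_nbr_3_4[of c3 c4 a c1 c2 z' b] cyc_rot[OF cyc_rot[OF cyc_rot[OF Ca]]]
        z'(1) ab b sym[OF ab] unfolding anti_def by blast
    \<comment> \<open>With \<open>b\<close> in place of \<open>a\<close>, \<open>z'\<close> is still
      an anticentre; if \<open>y\<close> missed \<open>b\<close>, it would see only
      \<open>c3\<close> on this cycle, against \<open>anti_nbr_1\<close>.\<close>
    have Cb3: "cyc c3 c4 b c1 c2" using cyc_rot Cb by blast
    have "anti c3 c4 b c1 c2 z'" using z' bz' sym_iff unfolding anti_def by metis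
    then have "\<not> typB c3 c4 b c1 c2 y" using anti_nbr_1[OF Cb3 _ z'(2)] by blast
    then have yb: "E y b" using y unfolding attached_def typA_def typB_def by blast
    show False
      using no_bull[of z' y a w b] y yb z' bz' wz' wy w ab sym_iff
      unfolding attached_def typA_def anti_def by metis
  qed
qed

text \<open>By \<open>mixed_on_edge_outside\<close> some non-twin \<open>w\<close> sees one end of
  an edge of twins and misses the other. Every pattern of \<open>w\<close> on \<open>c1\<close>,
  \<open>c2\<close>, \<open>c3\<close>, \<open>c4\<close> is then excluded.\<close>

lemma twins_stable:
  assumes C: "cyc c0 c1 c2 c3 c4" and z: "anti c0 c1 c2 c3 c4 z"
    and a: "E a c1" "E a c4" "\<not> E a c2" "\<not> E a c3"
    and b: "E b c1" "E b c4" "\<not> E b c2" "\<not> E b c3"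
  shows "\<not> E a b"
proof
  assume ab: "E a b"
  let ?P = "{a. E a c1 \<and> E a c4 \<and> \<not> E a c2 \<and> \<not> E a c3}"
  have "c1 \<in> V" "c1 \<notin> ?P" using dom cycD[OF C] irrefl by blast+
  moreover have "?P \<subseteq> V" using dom by blast
  ultimately have "?P \<subset> V" by blast
  then obtain a b w where ab: "a \<in> ?P" "b \<in> ?P" "E a b" and w: "w \<notin> ?P" "E w a" "\<not> E w b"
    using mixed_on_edge_outside[OF ab, of ?P] a b by blast
  from ab have a: "E a c1" "E a c4" "\<not> E a c2" "\<not> E a c3"
    and b: "E b c1" "E b c4" "\<not> E b c2" "\<not> E b c3" by blast+
  have Ca: "cyc a c1 c2 c3 c4" and Cb: "cyc b c1 c2 c3 c4"
    using cycD[OF C] a b sym_iff unfolding cyc_def by metis+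
  have 1: "E w c1 \<or> E w c2"
    using no_bull[of w a c1 c2 b] cycD[OF C] a b ab w sym_iff by metis
  have 2: "E w c4 \<or> E w c3"
    using no_bull[of w a c4 c3 b] cycD[OF C] a b ab w sym_iff by metis
  \<comment> \<open>Facts 3 and 4 use the cycle through \<open>b\<close>, which \<open>w\<close>
    misses; facts 5 to 7 use the cycle through \<open>a\<close>, which \<open>w\<close>
    sees.\<close>
  have 3: "\<not> (E w c1 \<and> E w c4 \<and> E w c2 \<and> \<not> E w c3)" 
    using three_neighbours[OF cyc_rot[OF Cb], of w] w sym_iff by metis
  have 4: "\<not> (E w c1 \<and> E w c4 \<and> E w c3 \<and> \<not> E w c2)"
    using three_neighbours[OF cyc_rot[OF cyc_flip[OF Cb]], of w] w sym_iff by metis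
  have 5: "\<not> (\<not> E w c1 \<and> \<not> E w c4 \<and> E w c2 \<and> E w c3)"
    using three_neighbours[OF cyc_rot[OF cyc_rot[OF Ca]], of w] w sym_iff by metis
  have 6: "\<not> (E w c1 \<and> \<not> E w c4 \<and> \<not> E w c2 \<and> E w c3)"
    using three_neighbours[OF Ca, of w] w sym_iff by metis
  have 7: "\<not> (\<not> E w c1 \<and> E w c4 \<and> E w c2 \<and> \<not> E w c3)"
    using three_neighbours[OF cyc_flip[OF Ca], of w] w sym_iff by metis
  have 8: "\<not> (E w c1 \<and> E w c2 \<and> E w c3)"
    using twins_mixed_outside[OF C z a b ab(3) w(2,3)] by blast
  have 9: "\<not> (E w c4 \<and> E w c3 \<and> E w c2)"
    using twins_mixed_outside[OF cyc_flip[OF C] anti_flip[OF z] a(2,1,4,3) b(2,1,4,3) ab(3) w(2,3)] by blast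
  show False using 1 2 3 4 5 6 7 8 9 w(1) by blast
qed

text \<open>Otherwise \<open>v\<close> and \<open>c0\<close> are adjacent twins, as
  \<open>c0\<close> counts as its own twin in \<open>twins_stable\<close>.\<close>

lemma no_three_consecutive:
  assumes "cyc c0 c1 c2 c3 c4" "anti c0 c1 c2 c3 c4 x" "E v c4" "E v c0" "E v c1" "\<not> E v c2"
  shows "E v c3"
  using twins_stable[OF assms(1,2), of c0 v] cycD[OF assms(1)] assms(3-) sym_iff by metis

text \<open>Two consecutive neighbours extend to three, three to four, and five are excluded by
  \<open>no_center\<close>.\<close>

lemma vertex_types:
  assumes C: "cyc c0 c1 c2 c3 c4" and x: "anti c0 c1 c2 c3 c4 x" and v: "v \<in> V"
  shows "anti c0 c1 c2 c3 c4 v \<or>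
    typA c0 c1 c2 c3 c4 v \<or> typA c1 c2 c3 c4 c0 v \<or> typA c2 c3 c4 c0 c1 v \<or>
    typA c3 c4 c0 c1 c2 v \<or> typA c4 c0 c1 c2 c3 v \<or>
    typB c0 c1 c2 c3 c4 v \<or> typB c1 c2 c3 c4 c0 v \<or> typB c2 c3 c4 c0 c1 v \<or>
    typB c3 c4 c0 c1 c2 v \<or> typB c4 c0 c1 c2 c3 v \<or>
    typT c0 c1 c2 c3 c4 v \<or> typT c1 c2 c3 c4 c0 v \<or> typT c2 c3 c4 c0 c1 v \<or>
    typT c3 c4 c0 c1 c2 v \<or> typT c4 c0 c1 c2 c3 v"
proof -
  note C1 = cyc_rot[OF C] note C2 = cyc_rot[OF C1] note C3 = cyc_rot[OF C2] note C4 = cyc_rot[OF C3]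
  note x1 = anti_rot[OF x] note x2 = anti_rot[OF x1] note x3 = anti_rot[OF x2] note x4 = anti_rot[OF x3]
  note 1 = edge_third_neighbour[OF C, of v] edge_third_neighbour[OF C1, of v] edge_third_neighbour[OF C2, of v] edge_third_neighbour[OF C3, of v] edge_third_neighbour[OF C4, of v]
  note 2 = three_neighbours[OF C, of v] three_neighbours[OF C1, of v] three_neighbours[OF C2, of v]
    three_neighbours[OF C3, of v] three_neighbours[OF C4, of v]
  note 3 = no_three_consecutive[OF C x, of v] no_three_consecutive[OF C1 x1, of v]
    no_three_consecutive[OF C2 x2, of v] no_three_consecutive[OF C3 x3, of v]
    no_three_consecutive[OF C4 x4, of v]
  show ?thesis
    using 1 2 3 no_center[OF C x, of v] v unfolding anti_def center_def typA_def typB_def typT_def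
    by argo
qed

section \<open>Adjacencies between the types\<close>

lemma typA_anti_anti:
  assumes "cyc c0 c1 c2 c3 c4" "anti c0 c1 c2 c3 c4 u" "anti c0 c1 c2 c3 c4 v"
    "typA c0 c1 c2 c3 c4 a" "E u v" "E a u"
  shows "E a v"
  using no_P6[of v u a c1 c2 c3] cycD[OF assms(1)] assms sym_iff unfolding anti_def typA_def by metis

text \<open>A vertex splitting an edge of anticentres is a twin by \<open>anti_nbr\<close>, and
  \<open>typA_anti_anti\<close> makes it see both ends.\<close>

lemma anti_stable:
  assumes C: "cyc c0 c1 c2 c3 c4" and u: "anti c0 c1 c2 c3 c4 u" and v: "anti c0 c1 c2 c3 c4 v"
  shows "\<not> E u v"
proof
  assume uv: "E u v"
  let ?P = "{z. anti c0 c1 c2 c3 c4 z}"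
  have "c0 \<in> V" "c0 \<notin> ?P" using dom cycD[OF C] unfolding anti_def by blast+
  then have "?P \<subset> V" unfolding anti_def by blast
  then obtain u v w where uv: "u \<in> ?P" "v \<in> ?P" "E u v" and w: "w \<notin> ?P" "E w u" "\<not> E w v"
    using mixed_on_edge_outside[OF uv, of ?P] u v by blast
  from uv have u: "anti c0 c1 c2 c3 c4 u" and v: "anti c0 c1 c2 c3 c4 v" by blast+
  note C1 = cyc_rot[OF C] note C2 = cyc_rot[OF C1] note C3 = cyc_rot[OF C2] note C4 = cyc_rot[OF C3]
  note u1 = anti_rot[OF u] note u2 = anti_rot[OF u1] note u3 = anti_rot[OF u2] note u4 = anti_rot[OF u3]
  note v1 = anti_rot[OF v] note v2 = anti_rot[OF v1] note v3 = anti_rot[OF v2] note v4 = anti_rot[OF v3]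
  show False
    using anti_nbr[OF C u w(2)] w no_center[OF C u] typA_anti_anti[OF C u v _ uv(3) w(2)]
      typA_anti_anti[OF C1 u1 v1 _ uv(3) w(2)] typA_anti_anti[OF C2 u2 v2 _ uv(3) w(2)]
      typA_anti_anti[OF C3 u3 v3 _ uv(3) w(2)] typA_anti_anti[OF C4 u4 v4 _ uv(3) w(2)] by blast
qed

lemma typA_typA_0:
  assumes "cyc c0 c1 c2 c3 c4" "anti c0 c1 c2 c3 c4 x"
    "typA c0 c1 c2 c3 c4 a" "typA c0 c1 c2 c3 c4 b"
  shows "\<not> E a b"
  using twins_stable[OF assms(1,2)] assms(3,4) unfolding typA_def by blast

lemma typA_typA_2:
  assumes "cyc c0 c1 c2 c3 c4" "typA c0 c1 c2 c3 c4 a" "typA c2 c3 c4 c0 c1 b"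
  shows "\<not> E a b"
  using no_bull[of c4 a c1 c2 b] cycD[OF assms(1)] assms sym_iff unfolding typA_def by metis

lemma typA_typB_1:
  assumes "cyc c0 c1 c2 c3 c4" "typA c0 c1 c2 c3 c4 a" "typB c1 c2 c3 c4 c0 b"
  shows "\<not> E a b"
  using no_bull[of c4 a c1 c2 b] cycD[OF assms(1)] assms sym_iff unfolding typA_def typB_def by metis

lemma typA_typB_4:
  assumes "cyc c0 c1 c2 c3 c4" "typA c0 c1 c2 c3 c4 a" "typB c4 c0 c1 c2 c3 b"
  shows "\<not> E a b"
  using no_bull[of c1 a c4 c3 b] cycD[OF assms(1)] assms sym_iff unfolding typA_def typB_def by metis

lemma typB_typB_1:
  assumes "cyc c0 c1 c2 c3 c4" "typB c0 c1 c2 c3 c4 a" "typB c1 c2 c3 c4 c0 b"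
  shows "\<not> E a b"
  using no_P6[of a b c1 c2 c3 c4] cycD[OF assms(1)] assms sym_iff unfolding typB_def by metis

text \<open>Here and in the next three lemmas, two cycle vertices pendant at two corners of the
  triangle would complete it to a bull.\<close>

lemma anti_typA_typA:
  assumes "cyc c0 c1 c2 c3 c4" "anti c0 c1 c2 c3 c4 w" "typA c0 c1 c2 c3 c4 a" "typA c1 c2 c3 c4 c0 b"
    "E a b" "E a w"
  shows "\<not> E b w"
  using no_bull[of c4 a b c2 w] cycD[OF assms(1)] assms sym_iff unfolding typA_def anti_def by metis

lemma typA_typA_typB:
  assumes "cyc c0 c1 c2 c3 c4" "typA c0 c1 c2 c3 c4 a" "typA c1 c2 c3 c4 c0 b" "typB c3 c4 c0 c1 c2 w"
    "E a b" "E a w"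
  shows "\<not> E b w"
  using no_bull[of c4 a b c2 w] cycD[OF assms(1)] assms sym_iff unfolding typA_def typB_def by metis

lemma typA_typB_typB_2:
  assumes "cyc c0 c1 c2 c3 c4" "typA c0 c1 c2 c3 c4 a" "typB c0 c1 c2 c3 c4 b" "typB c2 c3 c4 c0 c1 w"
    "E a b" "E a w"
  shows "\<not> E b w"
  using no_bull[of c4 a w c2 b] cycD[OF assms(1)] assms sym_iff unfolding typA_def typB_def by metis

lemma typA_typB_typB_3:
  assumes "cyc c0 c1 c2 c3 c4" "typA c0 c1 c2 c3 c4 a" "typB c0 c1 c2 c3 c4 b" "typB c3 c4 c0 c1 c2 w"
    "E a b" "E a w"
  shows "\<not> E b w"
  using no_bull[of c1 a w c3 b] cycD[OF assms(1)] assms sym_iff unfolding typA_def typB_def by metis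

lemma typB_mixed_typA:
  assumes "cyc c0 c1 c2 c3 c4" "typB c0 c1 c2 c3 c4 a" "typB c0 c1 c2 c3 c4 b" "E a b"
    "typA c0 c1 c2 c3 c4 w" "E w a"
  shows "E w b"
  using no_P6[of b a w c1 c2 c3] cycD[OF assms(1)] assms sym_iff unfolding typA_def typB_def by metis

lemma attached_typT_typB:
  assumes "attached c0 c1 c2 c3 c4 y z" "typT c0 c1 c2 c3 c4 t" "typB c0 c1 c2 c3 c4 b" "E t b"
  shows "E y b"
proof -
  have C: "cyc c0 c1 c2 c3 c4" using assms(1) unfolding attached_def by blast
  show ?thesis
    using no_bull[of b t c1 y c2] cycD[OF C] assms attached_typT_0[OF assms(1,2)] sym_iff
    unfolding attached_def typA_def typT_def typB_def by metis
qed

text \<open>An attached \<open>y\<close> sees \<open>a\<close> and then also \<open>b\<close>; if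
  \<open>w\<close> misses \<open>b\<close>, the triangle \<open>y a b\<close> with pendants
  \<open>z\<close> at \<open>y\<close> and \<open>w\<close> at \<open>a\<close> is a bull.\<close>

lemma typB_mixed_typT_0:
  assumes C: "cyc c0 c1 c2 c3 c4" and x: "anti c0 c1 c2 c3 c4 x"
    and a: "typB c0 c1 c2 c3 c4 a" and b: "typB c0 c1 c2 c3 c4 b" and ab: "E a b"
    and w: "typT c0 c1 c2 c3 c4 w" "E w a"
  shows "E w b"
proof (rule ccontr)
  assume wb: "\<not> E w b"
  obtain y z where y: "attached c0 c1 c2 c3 c4 y z" using typT_attached_ex[OF C x w(1)] by blast
  then have yA: "typA c0 c1 c2 c3 c4 y" and z: "anti c0 c1 c2 c3 c4 z" "E y z" unfolding attached_def by blast+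
  have ya: "E y a" by (rule attached_typT_typB[OF y w(1) a w(2)])
  have yb: "E y b" by (rule typB_mixed_typA[OF C a b ab yA ya])
  have "\<not> E a z" "\<not> E b z" using anti_nbr_1[OF C z(1)] a b by blast+
  then show False
    using no_bull[of z y a w b] attached_typT_0[OF y w(1)] anti_typT[OF C z(1) w(1)] ya yb z ab w wb sym_iff
    by metis
qed

lemma typB_mixed_typT_1:
  assumes C: "cyc c0 c1 c2 c3 c4" and x: "anti c0 c1 c2 c3 c4 x"
    and a: "typB c0 c1 c2 c3 c4 a" and w: "typT c1 c2 c3 c4 c0 w"
  shows "\<not> E w a"
proof
  assume wa: "E w a"
  obtain y z where y: "attached c1 c2 c3 c4 c0 y z" using typT_attached_ex[OF cyc_rot[OF C] anti_rot[OF x] w] by blast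
  then have yA: "typA c1 c2 c3 c4 c0 y" unfolding attached_def by blast
  have "\<not> E y a" using typA_typB_4[OF cyc_rot[OF C] yA a] .
  then show False
    using no_bull[of y c0 w c3 a] cycD[OF C] attached_typT_0[OF y w] wa w a yA sym_iff
    unfolding typA_def typB_def typT_def by metis
qed

text \<open>If \<open>w\<close> misses \<open>b\<close>, the triangle \<open>c0 c1 w\<close> forces
  a vertex \<open>y\<close> attached at \<open>c2\<close> to see \<open>b\<close>. Whether or not
  \<open>y\<close> sees \<open>a\<close>, a bull through the edge \<open>ab\<close> follows.\<close>

lemma typB_mixed_typT_2:
  assumes C: "cyc c0 c1 c2 c3 c4" and x: "anti c0 c1 c2 c3 c4 x"
    and a: "typB c0 c1 c2 c3 c4 a" and b: "typB c0 c1 c2 c3 c4 b" and ab: "E a b"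
    and w: "typT c2 c3 c4 c0 c1 w" "E w a"
  shows "E w b"
proof (rule ccontr)
  assume wb: "\<not> E w b"
  obtain y z where y: "attached c2 c3 c4 c0 c1 y z"
    using typT_attached_ex[OF cyc_rot[OF cyc_rot[OF C]] anti_rot[OF anti_rot[OF x]] w(1)] by blast
  then have yA: "typA c2 c3 c4 c0 c1 y" and z': "anti c2 c3 c4 c0 c1 z" "E y z" unfolding attached_def by blast+
  have z: "anti c0 c1 c2 c3 c4 z" using z'(1) unfolding anti_def by blast
  note wy = attached_typT_0[OF y w(1)]
  have wz: "\<not> E w z" using anti_typT[OF cyc_rot[OF cyc_rot[OF C]] z'(1) w(1)] .
  have abz: "\<not> E a z" "\<not> E b z" using anti_nbr_1[OF C z] a b by blast+
  have yb: "E y b"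
    using no_bull[of b c0 c1 y w] cycD[OF C] wy w wb b yA sym_iff
    unfolding typA_def typB_def typT_def by metis
  show False
  proof (cases "E y a")
    case True
    then show False
      using no_bull[of z y a w b] wy wz abz yb z' ab w wb sym_iff by metis
  next
    case False
    then show False
      using no_bull[of y b c0 c4 a] cycD[OF C] yb ab a b yA sym_iff
      unfolding typA_def typB_def by metis
  qed
qed

text \<open>A vertex splitting an edge of the class sees \<open>c0\<close>, or both
  \<open>c1\<close> and \<open>c4\<close>, by facts 1 and 2; the preceding lemmas exclude each type
  of this kind.\<close>

lemma typB_stable:
  assumes C: "cyc c0 c1 c2 c3 c4" and x: "anti c0 c1 c2 c3 c4 x"
    and a: "typB c0 c1 c2 c3 c4 a" and b: "typB c0 c1 c2 c3 c4 b"
  shows "\<not> E a b"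
proof
  assume ab: "E a b"
  let ?P = "{a. typB c0 c1 c2 c3 c4 a}"
  have "c0 \<in> V" "c0 \<notin> ?P" using dom cycD[OF C] unfolding typB_def by blast+
  then have "?P \<subset> V" using dom unfolding typB_def by blast
  then obtain a b w where ab: "a \<in> ?P" "b \<in> ?P" "E a b" and w: "w \<notin> ?P" "E w a" "\<not> E w b"
    using mixed_on_edge_outside[OF ab, of ?P] a b by blast
  from ab have a: "typB c0 c1 c2 c3 c4 a" and b: "typB c0 c1 c2 c3 c4 b" by blast+
  have 1: "E w c0 \<or> E w c1"
    using no_bull[of w a c0 c1 b] cycD[OF C] a b ab w sym_iff unfolding typB_def by metis
  have 2: "E w c0 \<or> E w c4"
    using no_bull[of w a c0 c4 b] cycD[OF C] a b ab w sym_iff unfolding typB_def by metis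
  have flips: "typB c0 c4 c3 c2 c1 a" "typB c0 c4 c3 c2 c1 b" using a b unfolding typB_def by blast+
  note Cf = cyc_flip[OF C] note xf = anti_flip[OF x]
  have "\<not> typA c1 c2 c3 c4 c0 w" using typA_typB_4[OF cyc_rot[OF C] _ a, of w] w by blast
  moreover have "\<not> typA c4 c0 c1 c2 c3 w"
    using typA_typB_1[OF cyc_rot[OF cyc_rot[OF cyc_rot[OF cyc_rot[OF C]]]] _ a, of w] w by blast
  moreover have "\<not> typA c0 c1 c2 c3 c4 w" using typB_mixed_typA[OF C a b ab(3)] w by blast
  moreover have "\<not> typT c0 c1 c2 c3 c4 w" using typB_mixed_typT_0[OF C x a b ab(3)] w by blast
  moreover have "\<not> typT c1 c2 c3 c4 c0 w" using typB_mixed_typT_1[OF C x a] w by blast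
  moreover have "\<not> typT c4 c3 c2 c1 c0 w" using typB_mixed_typT_1[OF Cf xf flips(1)] w by blast
  moreover have "\<not> typT c2 c3 c4 c0 c1 w" using typB_mixed_typT_2[OF C x a b ab(3)] w by blast
  moreover have "\<not> typT c3 c2 c1 c0 c4 w" using typB_mixed_typT_2[OF Cf xf flips ab(3)] w by blast
  moreover have "w \<in> V" using w dom by blast
  moreover have "\<not> typB c0 c1 c2 c3 c4 w" using w by blast
  ultimately show False
    using vertex_types[OF C x, of w] 1 2 unfolding typA_def typB_def typT_def anti_def by argo
qed

section \<open>Triangles and the four-neighbour vertices\<close>

definition typTs :: "'a \<Rightarrow> 'a \<Rightarrow> 'a \<Rightarrow> 'a \<Rightarrow> 'a \<Rightarrow> 'a \<Rightarrow> bool" where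
  "typTs c0 c1 c2 c3 c4 v \<longleftrightarrow> typT c0 c1 c2 c3 c4 v \<or> typT c1 c2 c3 c4 c0 v \<or>
    typT c2 c3 c4 c0 c1 v \<or> typT c3 c4 c0 c1 c2 v \<or> typT c4 c0 c1 c2 c3 v"

lemma typTs_rot: "typTs c1 c2 c3 c4 c0 v \<longleftrightarrow> typTs c0 c1 c2 c3 c4 v"
  unfolding typTs_def by blast

lemma nbr_typA:
  assumes C: "cyc c0 c1 c2 c3 c4" and x: "anti c0 c1 c2 c3 c4 x"
    and a: "typA c0 c1 c2 c3 c4 a" and v: "E a v" "\<not> typTs c0 c1 c2 c3 c4 v"
  shows "anti c0 c1 c2 c3 c4 v \<or> typA c1 c2 c3 c4 c0 v \<or> typA c4 c0 c1 c2 c3 v \<or>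
    typB c0 c1 c2 c3 c4 v \<or> typB c2 c3 c4 c0 c1 v \<or> typB c3 c4 c0 c1 c2 v"
proof -
  note C1 = cyc_rot[OF C] note C2 = cyc_rot[OF C1] note C3 = cyc_rot[OF C2]
  have "v \<in> V" "E v a" using v dom sym by blast+
  then show ?thesis
    using vertex_types[OF C x, of v] v a typA_typA_0[OF C x a, of v] typA_typA_2[OF C a, of v]
      typA_typA_2[OF C3, of v a] typA_typB_1[OF C a, of v] typA_typB_4[OF C a, of v]
    unfolding typTs_def by blast
qed

lemma nbr_typB:
  assumes C: "cyc c0 c1 c2 c3 c4" and x: "anti c0 c1 c2 c3 c4 x"
    and a: "typB c0 c1 c2 c3 c4 a" and v: "E a v" "\<not> typTs c0 c1 c2 c3 c4 v"
  shows "typA c0 c1 c2 c3 c4 v \<or> typA c2 c3 c4 c0 c1 v \<or> typA c3 c4 c0 c1 c2 v \<or>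
    typB c2 c3 c4 c0 c1 v \<or> typB c3 c4 c0 c1 c2 v"
proof -
  note C1 = cyc_rot[OF C] note C2 = cyc_rot[OF C1] note C3 = cyc_rot[OF C2] note C4 = cyc_rot[OF C3]
  have "v \<in> V" "E v a" using v dom sym by blast+
  then show ?thesis
    using vertex_types[OF C x, of v] v a typB_stable[OF C x a, of v] typB_typB_1[OF C a, of v]
      typB_typB_1[OF C4, of v a] typA_typB_1[OF C4, of v a] typA_typB_4[OF C1, of v a]
      anti_nbr_1[OF C, of v a]
    unfolding typTs_def by blast
qed

lemma nbr_anti:
  assumes C: "cyc c0 c1 c2 c3 c4" and x: "anti c0 c1 c2 c3 c4 a" and v: "E a v"
  shows "typA c0 c1 c2 c3 c4 v \<or> typA c1 c2 c3 c4 c0 v \<or> typA c2 c3 c4 c0 c1 v \<or>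
    typA c3 c4 c0 c1 c2 v \<or> typA c4 c0 c1 c2 c3 v"
  using anti_nbr[OF C x sym[OF v]] anti_stable[OF C x, of v] no_center[OF C x, of v] v by blast

text \<open>The candidates from \<open>nbr_typA\<close> are eliminated in turn: anticentres in
  \<open>W\<close>, twins of \<open>c1\<close> and \<open>c4\<close> in \<open>A1\<close> and
  \<open>A4\<close>, and finally pairs of vertices with one neighbour on the cycle.\<close>

lemma no_triangle_typA:
  assumes C: "cyc c0 c1 c2 c3 c4" and x: "anti c0 c1 c2 c3 c4 x"
    and a: "typA c0 c1 c2 c3 c4 a"
    and u: "E a u" "\<not> typTs c0 c1 c2 c3 c4 u" and v: "E a v" "\<not> typTs c0 c1 c2 c3 c4 v"
  shows "\<not> E u v"
proof
  assume uv: "E u v"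
  then have vu: "E v u" by (rule sym)
  have ua: "E u a" and va: "E v a" using u v sym by blast+
  note C1 = cyc_rot[OF C] note C2 = cyc_rot[OF C1] note C3 = cyc_rot[OF C2] note C4 = cyc_rot[OF C3]
  note x1 = anti_rot[OF x] note x2 = anti_rot[OF x1] note x3 = anti_rot[OF x2] note x4 = anti_rot[OF x3]
  note T = u(1) v(1) ua va uv vu
  have anti4: "anti c4 c0 c1 c2 c3 w \<longleftrightarrow> anti c0 c1 c2 c3 c4 w" for w unfolding anti_def by blast
  have W: "\<not> anti c0 c1 c2 c3 c4 p" if "E p q" "E q p" "E a p" "E a q" "E q a" "E p a"
    "\<not> typTs c0 c1 c2 c3 c4 q" for p q
    using nbr_typA[OF C x a that(4,7)] that anti_stable[OF C, of p q]
      anti_typA_typA[OF C _ a, of p q] anti_typA_typA[OF C4, of p q a] anti4[of p] a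
      anti_nbr_1[OF C, of p q] anti_nbr_1[OF C2, of p q] anti_nbr_1[OF C3, of p q]
      anti_rot[of c0 c1 c2 c3 c4 p] anti_rot[of c1 c2 c3 c4 c0 p] anti_rot[of c2 c3 c4 c0 c1 p] by blast
  have A1: "\<not> typA c1 c2 c3 c4 c0 p" if "E p q" "E q p" "E a p" "E a q" "E q a" "E p a"
    "\<not> typTs c0 c1 c2 c3 c4 q" "\<not> anti c0 c1 c2 c3 c4 q" for p q
    using nbr_typA[OF C x a that(4,7)] that typA_typA_0[OF C1 x1, of p q] typA_typA_2[OF C4, of q p]
      typA_typB_4[OF C1, of p q] typA_typB_1[OF C1, of p q] typA_typA_typB[OF C a, of p q] by blast
  have A4: "\<not> typA c4 c0 c1 c2 c3 p" if "E p q" "E q p" "E a p" "E a q" "E q a" "E p a"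
    "\<not> typTs c0 c1 c2 c3 c4 q" "\<not> anti c0 c1 c2 c3 c4 q" for p q
    using nbr_typA[OF C x a that(4,7)] that typA_typA_0[OF C4 x4, of p q] typA_typA_2[OF C4, of p q]
      typA_typB_4[OF C4, of p q] typA_typB_1[OF C4, of p q] typA_typA_typB[OF C4 _ a, of p q] by blast
  note nW = W[OF uv vu u(1) v(1) va ua v(2)] W[OF vu uv v(1) u(1) ua va u(2)]
  note nA = A1[OF uv vu u(1) v(1) va ua v(2) nW(2)] A1[OF vu uv v(1) u(1) ua va u(2) nW(1)]
    A4[OF uv vu u(1) v(1) va ua v(2) nW(2)] A4[OF vu uv v(1) u(1) ua va u(2) nW(1)]
  show False
    using nbr_typA[OF C x a u] nbr_typA[OF C x a v] nW nA T
      typB_stable[OF C x, of u v] typB_stable[OF C2 x2, of u v] typB_stable[OF C3 x3, of u v]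
      typB_typB_1[OF C2, of u v] typB_typB_1[OF C2, of v u]
      typA_typB_typB_2[OF C a, of u v] typA_typB_typB_2[OF C a, of v u]
      typA_typB_typB_3[OF C a, of u v] typA_typB_typB_3[OF C a, of v u] by blast
qed

text \<open>Twins are excluded by \<open>no_triangle_typA\<close>, hence also anticentres, whose
  neighbours are all twins. If a corner sees only \<open>c0\<close>, the other two each see only
  \<open>c2\<close> or only \<open>c3\<close>, and such vertices are pairwise nonadjacent.\<close>

lemma triangle_meets_typTs:
  assumes C: "cyc c0 c1 c2 c3 c4" and x: "anti c0 c1 c2 c3 c4 x"
    and t: "E p q" "E q r" "E p r"
  shows "typTs c0 c1 c2 c3 c4 p \<or> typTs c0 c1 c2 c3 c4 q \<or> typTs c0 c1 c2 c3 c4 r"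
proof (rule ccontr)
  assume "\<not> ?thesis"
  then have T: "\<not> typTs c0 c1 c2 c3 c4 p" "\<not> typTs c0 c1 c2 c3 c4 q" "\<not> typTs c0 c1 c2 c3 c4 r" by blast+
  note C1 = cyc_rot[OF C] note C2 = cyc_rot[OF C1] note C3 = cyc_rot[OF C2] note C4 = cyc_rot[OF C3]
  note x1 = anti_rot[OF x] note x2 = anti_rot[OF x1] note x3 = anti_rot[OF x2] note x4 = anti_rot[OF x3]
  note R = typTs_rot[of c1 c2 c3 c4 c0] typTs_rot[of c2 c3 c4 c0 c1] typTs_rot[of c3 c4 c0 c1 c2]
    typTs_rot[of c4 c0 c1 c2 c3]
  note t' = t[THEN sym]
  let ?A = "\<lambda>v. typA c0 c1 c2 c3 c4 v \<or> typA c1 c2 c3 c4 c0 v \<or> typA c2 c3 c4 c0 c1 v \<or>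
    typA c3 c4 c0 c1 c2 v \<or> typA c4 c0 c1 c2 c3 v"
  have A: "\<not> ?A a" if "E a u" "E a v" "E u v"
    "\<not> typTs c0 c1 c2 c3 c4 u" "\<not> typTs c0 c1 c2 c3 c4 v" for a u v
    using that no_triangle_typA[OF C x, of a u v] no_triangle_typA[OF C1 x1, of a u v]
      no_triangle_typA[OF C2 x2, of a u v] no_triangle_typA[OF C3 x3, of a u v]
      no_triangle_typA[OF C4 x4, of a u v] unfolding R by blast
  note nA = A[OF t(1,3,2) T(2,3)] A[OF t'(1) t(2,3) T(1,3)] A[OF t'(3,2) t(1) T(1,2)]
  \<comment> \<open>The labels are generalised so that the fact applies to every rotation.\<close>
  have B: "\<not> typB c0 c1 c2 c3 c4 a" if "cyc c0 c1 c2 c3 c4" "anti c0 c1 c2 c3 c4 x" "E a u" "E a v" "E u v"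
    "\<not> typTs c0 c1 c2 c3 c4 u" "\<not> typTs c0 c1 c2 c3 c4 v"
    "\<not> typA c0 c1 c2 c3 c4 u" "\<not> typA c2 c3 c4 c0 c1 u" "\<not> typA c3 c4 c0 c1 c2 u"
    "\<not> typA c0 c1 c2 c3 c4 v" "\<not> typA c2 c3 c4 c0 c1 v" "\<not> typA c3 c4 c0 c1 c2 v"
    for c0 c1 c2 c3 c4 a u v
  proof
    assume a: "typB c0 c1 c2 c3 c4 a"
    note D2 = cyc_rot[OF cyc_rot[OF that(1)]] note y2 = anti_rot[OF anti_rot[OF that(2)]]
    show False
      using nbr_typB[OF that(1,2) a that(3,6)] nbr_typB[OF that(1,2) a that(4,7)] that(8-) that(5)
        sym[OF that(5)] typB_stable[OF D2 y2, of u v] typB_stable[OF cyc_rot[OF D2] anti_rot[OF y2], of u v]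
        typB_typB_1[OF D2, of u v] typB_typB_1[OF D2, of v u] by blast
  qed
  have "\<not> anti c0 c1 c2 c3 c4 p" using nbr_anti[OF C _ t(1)] nA by blast
  then show False
    using vertex_types[OF C x, of p] dom[OF t(1)] nA T
      B[OF C x t(1,3,2)] B[OF C1 x1 t(1,3,2)] B[OF C2 x2 t(1,3,2)]
      B[OF C3 x3 t(1,3,2)] B[OF C4 x4 t(1,3,2)]
    unfolding R typTs_def[of c0 c1 c2 c3 c4] by blast
qed

section \<open>The four-neighbour vertices form a clique\<close>

lemma typT_typA_0:
  assumes "cyc c0 c1 c2 c3 c4" "typT c0 c1 c2 c3 c4 t" "typA c0 c1 c2 c3 c4 w"
  shows "\<not> E t w"
  using no_bull[of c3 t c1 c0 w] cycD[OF assms(1)] assms sym_iff unfolding typA_def typT_def by metis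

lemma typT_typA_1:
  assumes "cyc c0 c1 c2 c3 c4" "typT c0 c1 c2 c3 c4 t" "typA c1 c2 c3 c4 c0 w"
  shows "E t w"
  using no_bull[of w c2 t c4 c1] cycD[OF assms(1)] assms sym_iff unfolding typA_def typT_def by metis

lemma typT_typA_2:
  assumes "cyc c0 c1 c2 c3 c4" "typT c0 c1 c2 c3 c4 t" "typA c2 c3 c4 c0 c1 w"
  shows "E t w"
  using no_bull[of w c1 t c4 c2] cycD[OF assms(1)] assms sym_iff unfolding typA_def typT_def by metis

lemma typT_typB_1:
  assumes "cyc c0 c1 c2 c3 c4" "typT c0 c1 c2 c3 c4 t" "typB c1 c2 c3 c4 c0 w"
  shows "\<not> E t w"
  using no_bull[of c0 c1 t c3 w] cycD[OF assms(1)] assms sym_iff unfolding typB_def typT_def by metis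

lemma typT_typB_2:
  assumes "cyc c0 c1 c2 c3 c4" "typT c0 c1 c2 c3 c4 t" "typB c2 c3 c4 c0 c1 w"
  shows "E t w"
  using no_bull[of w c2 t c4 c1] cycD[OF assms(1)] assms sym_iff unfolding typB_def typT_def by metis

text \<open>The type of \<open>w\<close> decides the adjacency unless \<open>w\<close> has four
  neighbours on the cycle or only \<open>c0\<close>; so few vertices can be mixed on two vertices
  missing \<open>c0\<close>.\<close>

lemma typT_nbrs:
  assumes C: "cyc c0 c1 c2 c3 c4" and t: "typT c0 c1 c2 c3 c4 t"
  shows "typA c0 c1 c2 c3 c4 w \<Longrightarrow> \<not> E t w" "typA c1 c2 c3 c4 c0 w \<Longrightarrow> E t w"
    "typA c2 c3 c4 c0 c1 w \<Longrightarrow> E t w" "typA c3 c4 c0 c1 c2 w \<Longrightarrow> E t w"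
    "typA c4 c0 c1 c2 c3 w \<Longrightarrow> E t w" "typB c1 c2 c3 c4 c0 w \<Longrightarrow> \<not> E t w"
    "typB c2 c3 c4 c0 c1 w \<Longrightarrow> E t w" "typB c3 c4 c0 c1 c2 w \<Longrightarrow> E t w"
    "typB c4 c0 c1 c2 c3 w \<Longrightarrow> \<not> E t w" "anti c0 c1 c2 c3 c4 w \<Longrightarrow> \<not> E t w"
proof -
  note Cf = cyc_flip[OF C]
  have tf: "typT c0 c4 c3 c2 c1 t" using t unfolding typT_def by blast
  have A: "typA d e f g h w \<longleftrightarrow> typA d h g f e w" "typB d e f g h w \<longleftrightarrow> typB d h g f e w" for d e f g h
    unfolding typA_def typB_def by blast+
  show "typA c0 c1 c2 c3 c4 w \<Longrightarrow> \<not> E t w" by (rule typT_typA_0[OF C t])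
  show "typA c1 c2 c3 c4 c0 w \<Longrightarrow> E t w" by (rule typT_typA_1[OF C t])
  show "typA c2 c3 c4 c0 c1 w \<Longrightarrow> E t w" by (rule typT_typA_2[OF C t])
  show "typA c3 c4 c0 c1 c2 w \<Longrightarrow> E t w" using typT_typA_2[OF Cf tf] A by blast
  show "typA c4 c0 c1 c2 c3 w \<Longrightarrow> E t w" using typT_typA_1[OF Cf tf] A by blast
  show "typB c1 c2 c3 c4 c0 w \<Longrightarrow> \<not> E t w" by (rule typT_typB_1[OF C t])
  show "typB c2 c3 c4 c0 c1 w \<Longrightarrow> E t w" by (rule typT_typB_2[OF C t])
  show "typB c3 c4 c0 c1 c2 w \<Longrightarrow> E t w" using typT_typB_2[OF Cf tf] A by blast
  show "typB c4 c0 c1 c2 c3 w \<Longrightarrow> \<not> E t w" using typT_typB_1[OF Cf tf] A by blast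
  show "anti c0 c1 c2 c3 c4 w \<Longrightarrow> \<not> E t w" using anti_typT[OF C _ t] by blast
qed

lemma attached_typTs:
  assumes "attached c0 c1 c2 c3 c4 y z"
  shows "typTs c0 c1 c2 c3 c4 v \<longleftrightarrow> typT c0 c1 c2 c3 c4 v"
  using attached_typT_1[OF assms] attached_typT_2[OF assms] attached_typT_3[OF assms] attached_typT_4[OF assms]
  unfolding typTs_def by blast

lemma mixed_on_non_edge_outside:
  assumes "\<not> E a b" "a \<noteq> b" "a \<in> P" "b \<in> P" "P \<subset> V"
  obtains a' b' w where "a' \<in> P" "b' \<in> P" "\<not> E a' b'" "a' \<noteq> b'" "w \<notin> P" "w \<in> V" "E w a'" "\<not> E w b'"
proof -
  interpret co: prime_bull_free V co by (rule prime_bull_free_co)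
  have "co a b" using assms unfolding co_def by blast
  from co.mixed_on_edge_outside[OF this assms(3-5)]
  obtain a' b' w where "a' \<in> P" "b' \<in> P" "co a' b'" "w \<notin> P" "co w a'" "\<not> co w b'" by blast
  \<comment> \<open>As \<open>w\<close> lies outside \<open>P\<close>, missing \<open>b'\<close> in
    the complement means seeing it in the graph; hence \<open>a'\<close> and \<open>b'\<close> are
    interchanged.\<close>
  then show thesis using that[of b' a' w] sym unfolding co_def by metis
qed

text \<open>A vertex \<open>w\<close> splitting a nonadjacent pair sees only \<open>c0\<close> on
  the cycle, hence sees \<open>y\<close>, and \<open>z y w u c2 v\<close> is an induced path on six
  vertices.\<close>

lemma typT_clique:
  assumes y: "attached c0 c1 c2 c3 c4 y z" and u: "typT c0 c1 c2 c3 c4 u" and v: "typT c0 c1 c2 c3 c4 v"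
    and "u \<noteq> v"
  shows "E u v"
proof (rule ccontr)
  assume uv: "\<not> E u v"
  have C: "cyc c0 c1 c2 c3 c4" and z: "anti c0 c1 c2 c3 c4 z" "E y z" and yA: "typA c0 c1 c2 c3 c4 y"
    using y unfolding attached_def by blast+
  let ?P = "{t. typT c0 c1 c2 c3 c4 t}"
  have "c0 \<in> V" "c0 \<notin> ?P" using dom cycD[OF C] unfolding typT_def by blast+
  then have "?P \<subset> V" using dom unfolding typT_def by blast
  then obtain u v w where uv: "u \<in> ?P" "v \<in> ?P" "\<not> E u v" "u \<noteq> v"
    and w: "w \<notin> ?P" "w \<in> V" "E w u" "\<not> E w v"
    using mixed_on_non_edge_outside[OF uv \<open>u \<noteq> v\<close>, of ?P] u v by blast
  from uv have u: "typT c0 c1 c2 c3 c4 u" and v: "typT c0 c1 c2 c3 c4 v" by blast+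
  have uw: "E u w" "\<not> E v w" using w sym by blast+
  have "\<not> typTs c0 c1 c2 c3 c4 w" using w(1) attached_typTs[OF y] by blast
  then have wB: "typB c0 c1 c2 c3 c4 w"
    using vertex_types[OF C z(1) w(2)] typT_nbrs[OF C u, of w] typT_nbrs[OF C v, of w] uw
    unfolding typTs_def by blast
  have "E y w" by (rule attached_typT_typB[OF y u wB uw(1)])
  moreover have "\<not> E y u" "\<not> E y v" using attached_typT_0[OF y] u v sym by blast+
  moreover have "\<not> E w z" using anti_nbr_1[OF C z(1)] wB by blast
  moreover have "\<not> E u z" "\<not> E v z" using anti_typT[OF C z(1)] u v by blast+
  ultimately show False
    using no_P6[of z y w u c2 v] uv(3) uw z yA u v wB sym_iff
    unfolding typA_def typB_def typT_def anti_def by metis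
qed

section \<open>Recovering the clique from a neighbour of the given vertex\<close>

text \<open>The set computed by the algorithm: \<open>y\<close> is a neighbour of the given vertex and \<open>r u\<close> is a
  common neighbour of \<open>u\<close> and \<open>y\<close>.\<close>

definition far :: "'a \<Rightarrow> 'a set" where
  "far y = {u \<in> V. \<not> E y u \<and> (\<exists>p. E y p \<and> E u p)}"

text \<open>The edge \<open>uv\<close> closes a triangle with \<open>r u\<close> or
  \<open>r v\<close>. These see \<open>y\<close> and so lie outside the clique; hence
  \<open>u\<close> or \<open>v\<close> lies in it.\<close>

definition bad :: "('a \<Rightarrow> 'a) \<Rightarrow> 'a \<Rightarrow> 'a \<Rightarrow> bool" where
  "bad r u v \<longleftrightarrow> E (r u) v \<or> E (r v) u"

text \<open>The vertex \<open>y\<close> belongs to \<open>far y\<close> once it has a neighbour, but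
  it has no neighbour in \<open>far y\<close>; the existential clause removes it.\<close>

definition hit :: "'a \<Rightarrow> ('a \<Rightarrow> 'a) \<Rightarrow> 'a set" where
  "hit y r = {u \<in> far y. (\<exists>v\<in>far y. E u v \<and> bad r u v) \<and> (\<forall>v\<in>far y. E u v \<longrightarrow> bad r u v)}"

text \<open>Apart from anticentres, \<open>t\<close> sees every other type that a neighbour of
  \<open>y\<close> can have. If \<open>q\<close> were an anticentre, \<open>v\<close> would be a
  twin of a vertex other than \<open>c0\<close>, and being attached there through \<open>q\<close>
  it would exclude \<open>t\<close>.\<close>

lemma attached_misses_typT:
  assumes y: "attached c0 c1 c2 c3 c4 y z" and t: "typT c0 c1 c2 c3 c4 t"
    and q: "E y q" "\<not> E t q" and v: "E v q" "E t v"
  shows "typB c0 c1 c2 c3 c4 q"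
proof -
  have C: "cyc c0 c1 c2 c3 c4" and z: "anti c0 c1 c2 c3 c4 z" "E y z" and yA: "typA c0 c1 c2 c3 c4 y"
    using y unfolding attached_def by blast+
  note C1 = cyc_rot[OF C] note C2 = cyc_rot[OF C1] note C3 = cyc_rot[OF C2] note C4 = cyc_rot[OF C3]
  have "\<not> typTs c0 c1 c2 c3 c4 q" using attached_typT_0[OF y] attached_typTs[OF y] q(1) sym by blast
  moreover have "\<not> anti c0 c1 c2 c3 c4 q"
  proof
    assume a: "anti c0 c1 c2 c3 c4 q"
    note a1 = anti_rot[OF a] note a2 = anti_rot[OF a1] note a3 = anti_rot[OF a2] note a4 = anti_rot[OF a3]
    have "attached c1 c2 c3 c4 c0 v q \<or> attached c2 c3 c4 c0 c1 v q \<or> attached c3 c4 c0 c1 c2 v q \<or> attached c4 c0 c1 c2 c3 v q"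
      using nbr_anti[OF C a sym[OF v(1)]] typT_nbrs(1)[OF C t, of v] v a1 a2 a3 a4 C1 C2 C3 C4
      unfolding attached_def by blast
    then show False
      using attached_typT_4[of c1 c2 c3 c4 c0 v q t] attached_typT_3[of c2 c3 c4 c0 c1 v q t]
        attached_typT_2[of c3 c4 c0 c1 c2 v q t] attached_typT_1[of c4 c0 c1 c2 c3 v q t] t by blast
  qed
  ultimately show ?thesis
    using nbr_typA[OF C z(1) yA q(1)] typT_nbrs[OF C t, of q] q(2) by blast
qed

text \<open>If both adjacencies fail, \<open>q\<close> sees only \<open>c0\<close> on the cycle. If
  \<open>v\<close> misses only \<open>c0\<close>, the same holds for \<open>p\<close>, and the
  triangle \<open>t v c1\<close> with pendants \<open>p\<close> and \<open>q\<close> is a bull.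
  Otherwise four types remain for \<open>v\<close>, each giving a bull on \<open>q\<close>,
  \<open>v\<close>, \<open>t\<close> and two cycle vertices.\<close>

lemma typT_edge_bad:
  assumes y: "attached c0 c1 c2 c3 c4 y z" and t: "typT c0 c1 c2 c3 c4 t"
    and p: "E y p" "E t p" and q: "E y q" "E v q" and v: "E t v"
  shows "E p v \<or> E q t"
proof (rule ccontr)
  assume "\<not> ?thesis"
  then have n: "\<not> E v p" "\<not> E t q" using sym by blast+
  have C: "cyc c0 c1 c2 c3 c4" and z: "anti c0 c1 c2 c3 c4 z" "E y z" and yA: "typA c0 c1 c2 c3 c4 y"
    using y unfolding attached_def by blast+
  have qB: "typB c0 c1 c2 c3 c4 q" by (rule attached_misses_typT[OF y t q(1) n(2) q(2) v])
  show False
  proof (cases "typT c0 c1 c2 c3 c4 v")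
    case True
    have pB: "typB c0 c1 c2 c3 c4 p" by (rule attached_misses_typT[OF y True p(1) n(1) p(2) sym[OF v]])
    show False
      using no_bull[of p t v q c1] typB_stable[OF C z(1) pB qB] pB qB t True p q v n sym_iff
      unfolding typB_def typT_def by metis
  next
    case False
    then have "\<not> typTs c0 c1 c2 c3 c4 v" using attached_typTs[OF y] by blast
    then consider "typA c2 c3 c4 c0 c1 v" | "typA c3 c4 c0 c1 c2 v" | "typB c2 c3 c4 c0 c1 v" |
        "typB c3 c4 c0 c1 c2 v"
      using nbr_typB[OF C z(1) qB sym[OF q(2)]] typT_nbrs(1)[OF C t, of v] v by blast
    then show False
    proof cases
      case 1
      then show False
        using no_bull[of q v t c4 c1] cycD[OF C] qB t q v n sym_iff
        unfolding typA_def typB_def typT_def by metis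
    next
      case 2
      then show False
        using no_bull[of q v t c1 c4] cycD[OF C] qB t q v n sym_iff
        unfolding typA_def typB_def typT_def by metis
    next
      case 3
      then show False
        using no_bull[of q v t c4 c2] cycD[OF C] qB t q v n sym_iff
        unfolding typB_def typT_def by metis
    next
      case 4
      then show False
        using no_bull[of q v t c1 c3] cycD[OF C] qB t q v n sym_iff
        unfolding typB_def typT_def by metis
    qed
  qed
qed

lemma hit_eq_typT:
  assumes y: "attached c0 c1 c2 c3 c4 y z" and r: "\<And>u. u \<in> far y \<Longrightarrow> E y (r u) \<and> E u (r u)"
  shows "hit y r = {t. typT c0 c1 c2 c3 c4 t}"
proof -
  have C: "cyc c0 c1 c2 c3 c4" and z: "anti c0 c1 c2 c3 c4 z" "E y z" and yA: "typA c0 c1 c2 c3 c4 y"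
    using y unfolding attached_def by blast+
  note cE = cycD[OF C]
  have far: "c2 \<in> far y" "c3 \<in> far y" using yA cE dom unfolding far_def typA_def by blast+
  have rT: "\<not> typT c0 c1 c2 c3 c4 (r u)" if "u \<in> far y" for u
    using r[OF that] attached_typT_0[OF y] sym by blast
  have T: "typT c0 c1 c2 c3 c4 u \<or> typT c0 c1 c2 c3 c4 v"
    if "u \<in> far y" "v \<in> far y" "E u v" "bad r u v" for u v
    using triangle_meets_typTs[OF C z(1), of "r u" u v] triangle_meets_typTs[OF C z(1), of "r v" v u]
      that r[OF that(1)] r[OF that(2)] rT sym unfolding attached_typTs[OF y] bad_def by blast
  show ?thesis
  proof (intro equalityI subsetI)
    fix u assume "u \<in> hit y r"
    then obtain v where u: "u \<in> far y" "v \<in> far y" "E u v" "bad r u v"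
      and all: "\<And>v. v \<in> far y \<Longrightarrow> E u v \<Longrightarrow> bad r u v"
      unfolding hit_def by blast
    have "typT c0 c1 c2 c3 c4 u"
    proof (rule ccontr)
      assume nu: "\<not> typT c0 c1 c2 c3 c4 u"
      then have v: "typT c0 c1 c2 c3 c4 v" using T[OF u] by blast
      have vu: "E v u" by (rule sym[OF u(3)])
      \<comment> \<open>An edge from \<open>u\<close> to \<open>c2\<close> or \<open>c3\<close>
        would be bad and would thus have an end in the clique.\<close>
      have "\<not> E u c2" "\<not> E u c3"
        using T[OF u(1) far(1) _ all[OF far(1)]] T[OF u(1) far(2) _ all[OF far(2)]] nu cE
        unfolding typT_def by blast+
      moreover have "u \<in> V" "\<not> E y u" using u(1) unfolding far_def by blast+
      moreover have "\<not> typB c0 c1 c2 c3 c4 u" using attached_typT_typB[OF y v _ vu] \<open>\<not> E y u\<close> by blast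
      moreover have "\<not> typTs c0 c1 c2 c3 c4 u" using nu attached_typTs[OF y] by blast
      ultimately show False
        using vertex_types[OF C z(1), of u] typT_nbrs(1,6,9,10)[OF C v, of u] vu
        unfolding typTs_def typA_def typB_def by blast
    qed
    then show "u \<in> {t. typT c0 c1 c2 c3 c4 t}" by blast
  next
    fix t assume "t \<in> {t. typT c0 c1 c2 c3 c4 t}"
    then have t: "typT c0 c1 c2 c3 c4 t" by blast
    have "t \<in> far y"
      using attached_typT_0[OF y t] t yA dom sym unfolding far_def typT_def typA_def by blast
    moreover have "E t c2" using t unfolding typT_def by blast
    moreover have "bad r t v" if "v \<in> far y" "E t v" for v
      using typT_edge_bad[OF y t _ _ _ _ that(2), of "r t" "r v"] r[OF \<open>t \<in> far y\<close>] r[OF that(1)]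
      unfolding bad_def by blast
    ultimately show "t \<in> hit y r" using far(1) unfolding hit_def by blast
  qed
qed

text \<open>By \<open>nbr_anti\<close> the neighbour \<open>y\<close> of \<open>x\<close> is a twin
  of some cycle vertex, so \<open>y\<close> is attached, with \<open>x\<close> as the anticentre, to
  the rotation that starts there.\<close>

theorem hit_clique_meets_triangles:
  assumes C: "cyc c0 c1 c2 c3 c4" and x: "anti c0 c1 c2 c3 c4 x" and xy: "E x y"
    and r: "\<And>u. u \<in> far y \<Longrightarrow> E y (r u) \<and> E u (r u)"
  shows "\<forall>u\<in>hit y r. \<forall>v\<in>hit y r. u \<noteq> v \<longrightarrow> E u v"
    and "E p q \<Longrightarrow> E q s \<Longrightarrow> E p s \<Longrightarrow> p \<in> hit y r \<or> q \<in> hit y r \<or> s \<in> hit y r"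
proof -
  note C1 = cyc_rot[OF C] note C2 = cyc_rot[OF C1] note C3 = cyc_rot[OF C2] note C4 = cyc_rot[OF C3]
  note x1 = anti_rot[OF x] note x2 = anti_rot[OF x1] note x3 = anti_rot[OF x2] note x4 = anti_rot[OF x3]
  obtain d0 d1 d2 d3 d4 where y: "attached d0 d1 d2 d3 d4 y x"
    using nbr_anti[OF C x xy] sym[OF xy] C C1 C2 C3 C4 x x1 x2 x3 x4 unfolding attached_def by blast
  then have D: "cyc d0 d1 d2 d3 d4" "anti d0 d1 d2 d3 d4 x" unfolding attached_def by blast+
  have h: "hit y r = {t. typT d0 d1 d2 d3 d4 t}" by (rule hit_eq_typT[OF y]) (rule r)
  show "\<forall>u\<in>hit y r. \<forall>v\<in>hit y r. u \<noteq> v \<longrightarrow> E u v"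
    unfolding h using typT_clique[OF y] by blast
  show "E p q \<Longrightarrow> E q s \<Longrightarrow> E p s \<Longrightarrow> p \<in> hit y r \<or> q \<in> hit y r \<or> s \<in> hit y r"
    unfolding h using triangle_meets_typTs[OF D, of p q s] attached_typTs[OF y] by blast
qed

lemma anti_has_neighbour:
  assumes C: "cyc c0 c1 c2 c3 c4" and x: "anti c0 c1 c2 c3 c4 x"
  shows "\<exists>y. E x y"
proof (rule ccontr)
  assume none: "\<not> ?thesis"
  have "\<exists>v d s. v \<notin> {x} \<and> d \<in> {x} \<and> E v d \<and> s \<in> {c0, c1, c2, c3, c4} \<and> \<not> E v s"
    using cycD[OF C] x cyc_subset[OF C] card_cyc[OF C] conn_cyc[OF C]
    by (intro attachment_not_complete) (auto simp: anti_def)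
  then show False using none sym by blast
qed

end

section \<open>The algorithm\<close>

definition runs :: "(nat \<Rightarrow> nat \<Rightarrow> bool) \<Rightarrow> com \<Rightarrow> state \<Rightarrow> nat \<Rightarrow> (state \<Rightarrow> bool) \<Rightarrow> bool" where
  "runs A p s b Q \<longleftrightarrow> (\<exists>t s'. exec A p s t s' \<and> t \<le> b \<and> Q s')"

lemma runs_conseq:
  assumes "runs A p s b Q" "b \<le> b'" "\<And>s'. Q s' \<Longrightarrow> Q' s'"
  shows "runs A p s b' Q'"
  using assms unfolding runs_def by (meson le_trans)

lemma runs_Skip: "1 \<le> b \<Longrightarrow> Q s \<Longrightarrow> runs A Skip s b Q"
  unfolding runs_def using exec_Skip by blast

lemma runs_Assign:
  "1 + expr_cost e \<le> b \<Longrightarrow> Q (s\<lparr>scalar := (scalar s)(v := expr_val A s e)\<rparr>) \<Longrightarrow> runs A (Assign v e) s b Q"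
  unfolding runs_def using exec_Assign by blast

lemma runs_Store:
  "1 + expr_cost e + expr_cost f \<le> b \<Longrightarrow>
    Q (s\<lparr>cell := (cell s)(a := (cell s a)(expr_val A s e := expr_val A s f))\<rparr>) \<Longrightarrow>
    runs A (Store a e f) s b Q"
  unfolding runs_def using exec_Store by blast

lemma runs_Seq:
  assumes "runs A p s b (\<lambda>s'. runs A q s' c Q)" "b + c \<le> d"
  shows "runs A (Seq p q) s d Q"
proof -
  obtain t s' t' s'' where "exec A p s t s'" "t \<le> b" "exec A q s' t' s''" "t' \<le> c" "Q s''"
    using assms(1) unfolding runs_def by blast
  then show ?thesis
    unfolding runs_def using exec_Seq assms(2) by (metis add_mono le_trans)
qed

lemma runs_If:
  assumes "1 + expr_cost e \<le> b"
    "expr_val A s e \<noteq> 0 \<Longrightarrow> runs A p s (b - (1 + expr_cost e)) Q"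
    "expr_val A s e = 0 \<Longrightarrow> runs A q s (b - (1 + expr_cost e)) Q"
  shows "runs A (If e p q) s b Q"
proof (cases "expr_val A s e = 0")
  case True
  then obtain t s' where "exec A q s t s'" "t \<le> b - (1 + expr_cost e)" "Q s'"
    using assms(3) unfolding runs_def by blast
  moreover from this have "1 + expr_cost e + t \<le> b" using assms(1) by linarith
  ultimately show ?thesis unfolding runs_def using exec_If_false[OF True] by blast
next
  case False
  then obtain t s' where "exec A p s t s'" "t \<le> b - (1 + expr_cost e)" "Q s'"
    using assms(2) unfolding runs_def by blast
  moreover from this have "1 + expr_cost e + t \<le> b" using assms(1) by linarith
  ultimately show ?thesis unfolding runs_def using exec_If_true[OF False] by blast
qed

definition for_loop :: "nat \<Rightarrow> com \<Rightarrow> com" where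
  "for_loop k p = Seq (Assign k (Lit 0))
    (While (Less (Scalar k) (Scalar 0)) (Seq p (Assign k (Succ (Scalar k)))))"

text \<open>A round costs 4 for the test, at most \<open>b\<close> for the body and 3 for the
  increment; the last, failing test costs 4.\<close>

lemma runs_while:
  assumes step: "\<And>j s. j < n \<Longrightarrow> I j s \<Longrightarrow> scalar s k = j \<Longrightarrow> scalar s 0 = n \<Longrightarrow>
      runs A p s b (\<lambda>s'. scalar s' k = j \<and> scalar s' 0 = n \<and>
        I (Suc j) (s'\<lparr>scalar := (scalar s')(k := Suc j)\<rparr>))"
    and k: "k \<noteq> 0" and s: "I j s" "scalar s k = j" "scalar s 0 = n" "j \<le> n"
  shows "runs A (While (Less (Scalar k) (Scalar 0)) (Seq p (Assign k (Succ (Scalar k))))) s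
    (4 + (n - j) * (b + 7)) (\<lambda>s'. scalar s' 0 = n \<and> I n s')"
  using s
proof (induction "n - j" arbitrary: j s)
  case 0
  then have "expr_val A s (Less (Scalar k) (Scalar 0)) = 0" by simp
  from exec_While_false[OF this] show ?case using 0 unfolding runs_def by fastforce
next
  case (Suc m)
  then have j: "j < n" by linarith
  let ?c = "Less (Scalar k) (Scalar 0)" and ?p = "Seq p (Assign k (Succ (Scalar k)))"
  from step[OF j Suc.prems(1-3)] obtain t s1 where
    s1: "exec A p s t s1" "t \<le> b" "scalar s1 k = j" "scalar s1 0 = n"
      "I (Suc j) (s1\<lparr>scalar := (scalar s1)(k := Suc j)\<rparr>)"
    unfolding runs_def by blast
  let ?s2 = "s1\<lparr>scalar := (scalar s1)(k := Suc j)\<rparr>"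
  have 2: "exec A ?p s (t + 3) ?s2"
    using exec_Seq[OF s1(1) exec_Assign[of A k "Succ (Scalar k)"]] s1(3) by (simp add: eval_nat_numeral)
  have "runs A (While ?c ?p) ?s2 (4 + (n - Suc j) * (b + 7)) (\<lambda>s'. scalar s' 0 = n \<and> I n s')"
    using Suc.hyps(1)[of "Suc j" ?s2] Suc.hyps(2) j s1 k by auto
  then obtain t' s' where s': "exec A (While ?c ?p) ?s2 t' s'" "t' \<le> 4 + (n - Suc j) * (b + 7)"
    "scalar s' 0 = n" "I n s'" unfolding runs_def by blast
  have "expr_val A s ?c \<noteq> 0" using Suc.prems j by simp
  from exec_While_true[OF this 2 s'(1)]
  have "exec A (While ?c ?p) s (4 + (t + 3) + t') s'" by (simp add: numeral_eq_Suc)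
  moreover have "n - j = Suc (n - Suc j)" using j by linarith
  then have "4 + (t + 3) + t' \<le> 4 + (n - j) * (b + 7)" using s'(2) s1(2) by simp
  ultimately show ?case unfolding runs_def using s' by blast
qed

text \<open>The constant 6 is 2 for initialising the counter and 4 for the last test.\<close>

lemma runs_for:
  assumes "\<And>j s. j < n \<Longrightarrow> I j s \<Longrightarrow> scalar s k = j \<Longrightarrow> scalar s 0 = n \<Longrightarrow>
      runs A p s b (\<lambda>s'. scalar s' k = j \<and> scalar s' 0 = n \<and>
        I (Suc j) (s'\<lparr>scalar := (scalar s')(k := Suc j)\<rparr>))"
    and "k \<noteq> 0" "scalar s 0 = n" "I 0 (s\<lparr>scalar := (scalar s)(k := 0)\<rparr>)"
    and "6 + n * (b + 7) \<le> d" and "\<And>s'. scalar s' 0 = n \<Longrightarrow> I n s' \<Longrightarrow> Q s'"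
  shows "runs A (for_loop k p) s d Q"
  unfolding for_loop_def
proof (rule runs_Seq)
  let ?s = "s\<lparr>scalar := (scalar s)(k := 0)\<rparr>"
  have "runs A (While (Less (Scalar k) (Scalar 0)) (Seq p (Assign k (Succ (Scalar k))))) ?s
    (4 + (n - 0) * (b + 7)) (\<lambda>s'. scalar s' 0 = n \<and> I n s')"
    by (rule runs_while[where I = I, OF assms(1)]) (use assms(2-4) in auto)
  then show "runs A (Assign k (Lit 0)) s 2 (\<lambda>s'. runs A
    (While (Less (Scalar k) (Scalar 0)) (Seq p (Assign k (Succ (Scalar k))))) s' (4 + n * (b + 7)) Q)"
    by (intro runs_Assign) (auto intro: runs_conseq assms(6))
qed (use assms(5) in simp)

section \<open>The three passes of the program\<close>

text \<open>Scalar 2 holds \<open>y\<close>. Array 1 holds \<open>r u + 1\<close> at \<open>u\<close>, or 0 if \<open>u\<close> is adjacent to \<open>y\<close> or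
  has no common neighbour with it. Arrays 2 and 3 flag the vertices having an edge that does,
  or does not, meet the clique.\<close>

definition find_neighbour :: com where
  "find_neighbour = for_loop 3
    (If (Adjacent (Scalar 1) (Scalar 3)) (Assign 2 (Scalar 3)) Skip)"

definition find_common_neighbours :: com where
  "find_common_neighbours = for_loop 3
    (If (Adjacent (Scalar 2) (Scalar 3)) Skip
      (for_loop 4
        (If (Adjacent (Scalar 2) (Scalar 4))
          (If (Adjacent (Scalar 3) (Scalar 4)) (Store 1 (Scalar 3) (Succ (Scalar 4))) Skip) Skip)))"

lemma runs_find_neighbour:
  assumes "scalar s 0 = n" "scalar s 1 = i" "\<exists>j<n. A i j"
  shows "runs A find_neighbour s (6 + n * 20) (\<lambda>s'. scalar s' 0 = n \<and> cell s' = cell s \<and> A i (scalar s' 2))"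
  unfolding find_neighbour_def
proof (rule runs_for[where n = n and b = 10 and I = "\<lambda>j s'. scalar s' 1 = i \<and> cell s' = cell s \<and>
    ((\<exists>j'<j. A i j') \<longrightarrow> A i (scalar s' 2))"])
  show "runs A (If (Adjacent (Scalar 1) (Scalar 3)) (Assign 2 (Scalar 3)) Skip) s' 10
    (\<lambda>s''. scalar s'' 3 = j \<and> scalar s'' 0 = n \<and>
      scalar (s''\<lparr>scalar := (scalar s'')(3 := Suc j)\<rparr>) 1 = i \<and>
      cell (s''\<lparr>scalar := (scalar s'')(3 := Suc j)\<rparr>) = cell s \<and>
      ((\<exists>j'<Suc j. A i j') \<longrightarrow> A i (scalar (s''\<lparr>scalar := (scalar s'')(3 := Suc j)\<rparr>) 2)))"
    if "scalar s' 1 = i \<and> cell s' = cell s \<and> ((\<exists>j'<j. A i j') \<longrightarrow> A i (scalar s' 2))"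
      "scalar s' 3 = j" "scalar s' 0 = n" for j s'
    using that by (intro runs_If runs_Assign runs_Skip) (auto simp: less_Suc_eq)
qed (use assms in auto)

definition common_ok :: "(nat \<Rightarrow> nat \<Rightarrow> bool) \<Rightarrow> nat \<Rightarrow> nat \<Rightarrow> (nat \<Rightarrow> nat) \<Rightarrow> nat \<Rightarrow> bool" where
  "common_ok A n y R u \<longleftrightarrow> (if R u = 0 then A y u \<or> \<not> (\<exists>p<n. A y p \<and> A u p)
    else \<not> A y u \<and> A y (R u - 1) \<and> A u (R u - 1))"

lemma common_ok_cong: "R u = R' u \<Longrightarrow> common_ok A n y R u \<longleftrightarrow> common_ok A n y R' u"
  unfolding common_ok_def by simp

lemma runs_find_common_neighbours_inner:
  assumes s: "scalar s 0 = n" "scalar s 2 = y" "scalar s 3 = u" "cell s 1 u = 0" "\<not> A y u"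
  shows "runs A (for_loop 4
        (If (Adjacent (Scalar 2) (Scalar 4))
          (If (Adjacent (Scalar 3) (Scalar 4)) (Store 1 (Scalar 3) (Succ (Scalar 4))) Skip) Skip))
    s (6 + n * 27) (\<lambda>s'. scalar s' 0 = n \<and> scalar s' 2 = y \<and> scalar s' 3 = u \<and>
      (\<forall>a v. (a, v) \<noteq> (1, u) \<longrightarrow> cell s' a v = cell s a v) \<and> common_ok A n y (cell s' 1) u)"
proof (rule runs_for[where n = n and b = 20 and I = "\<lambda>p s'. scalar s' 2 = y \<and> scalar s' 3 = u \<and>
      (\<forall>a v. (a, v) \<noteq> (1, u) \<longrightarrow> cell s' a v = cell s a v) \<and>
      (if cell s' 1 u = 0 then \<not> (\<exists>p'<p. A y p' \<and> A u p')
       else A y (cell s' 1 u - 1) \<and> A u (cell s' 1 u - 1))"], goal_cases)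
  case (1 p s')
  then show ?case
    by (intro runs_If runs_Store runs_Skip) (auto simp: less_Suc_eq)
next
  case (6 s')
  then show ?case using s(5) unfolding common_ok_def by auto
qed (use s in auto)

lemma runs_find_common_neighbours:
  assumes s: "scalar s 0 = n" "scalar s 2 = y" "cell s = (\<lambda>_ _. 0)"
  shows "runs A find_common_neighbours s (6 + n * (17 + n * 27)) (\<lambda>s'. scalar s' 0 = n \<and>
    (\<forall>a v. cell s' a v \<noteq> 0 \<longrightarrow> a = 1 \<and> v < n) \<and> (\<forall>u<n. common_ok A n y (cell s' 1) u))"
proof -
  define I where "I u s' \<longleftrightarrow> scalar s' 2 = y \<and> (\<forall>a v. cell s' a v \<noteq> 0 \<longrightarrow> a = 1 \<and> v < u) \<and>
    (\<forall>v<u. common_ok A n y (cell s' 1) v)" for u and s' :: state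
  have counter: "I u (s'\<lparr>scalar := (scalar s')(3 := k)\<rparr>) \<longleftrightarrow> I u s'" for u s' k
    unfolding I_def by simp
  \<comment> \<open>Round \<open>u\<close> changes only entry \<open>u\<close> of array 1, so the
    facts about earlier entries persist.\<close>
  have step: "I (Suc u) s''"
    if I: "I u s'" and s'': "scalar s'' 2 = y" "\<And>a v. (a, v) \<noteq> (1, u) \<Longrightarrow> cell s'' a v = cell s' a v"
      "common_ok A n y (cell s'' 1) u" for u s' s''
    unfolding I_def
  proof (intro conjI allI impI)
    fix a v assume "cell s'' a v \<noteq> 0"
    then have "(a, v) = (1, u) \<or> cell s' a v \<noteq> 0" using s''(2)[of a v] by force
    then show "a = 1" "v < Suc u" using I less_Suc_eq unfolding I_def by blast+
  next
    fix v assume "v < Suc u"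
    then consider "v = u" | "v < u" "cell s'' 1 v = cell s' 1 v" using s''(2)[of 1 v] less_Suc_eq by auto
    then show "common_ok A n y (cell s'' 1) v"
      using I s''(3) common_ok_cong[of "cell s'' 1" v "cell s' 1"] unfolding I_def by cases blast+
  qed (rule s''(1))
  show ?thesis
    unfolding find_common_neighbours_def
  \<comment> \<open>The 4 pays for the adjacency test, the rest for the inner loop.\<close>
  proof (rule runs_for[where n = n and b = "4 + (6 + n * 27)" and I = I], goal_cases)
    case (1 u s')
    then have u: "cell s' 1 u = 0" "scalar s' 2 = y" unfolding I_def by blast+
    show ?case
      unfolding counter
    proof (rule runs_If)
      assume "expr_val A s' (Adjacent (Scalar 2) (Scalar 3)) = 0"
      then have "\<not> A y u" using 1 u by simp
      from runs_find_common_neighbours_inner[where A = A, OF 1(4) u(2) 1(3) u(1) this]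
      show "runs A (for_loop 4
          (If (Adjacent (Scalar 2) (Scalar 4))
            (If (Adjacent (Scalar 3) (Scalar 4)) (Store 1 (Scalar 3) (Succ (Scalar 4))) Skip) Skip))
        s' (4 + (6 + n * 27) - (1 + expr_cost (Adjacent (Scalar 2) (Scalar 3))))
        (\<lambda>s''. scalar s'' 3 = u \<and> scalar s'' 0 = n \<and> I (Suc u) s'')"
        by (rule runs_conseq) (use step[OF 1(2)] in auto)
    next
      assume "expr_val A s' (Adjacent (Scalar 2) (Scalar 3)) \<noteq> 0"
      then have "A y u" using 1 u by (simp split: if_splits)
      then have "common_ok A n y (cell s' 1) u" using u unfolding common_ok_def by simp
      then have "I (Suc u) s'" using step[OF 1(2) u(2)] by blast
      then show "runs A Skip s' (4 + (6 + n * 27) - (1 + expr_cost (Adjacent (Scalar 2) (Scalar 3))))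
        (\<lambda>s''. scalar s'' 3 = u \<and> scalar s'' 0 = n \<and> I (Suc u) s'')"
        using 1 by (intro runs_Skip) auto
    qed simp
  next
    case 4
    show ?case using s unfolding counter I_def by simp
  next
    case (6 s')
    then show ?case unfolding I_def by blast
  qed (use s in \<open>auto simp: algebra_simps\<close>)
qed

text \<open>The predicate \<open>bad\<close> on vertex numbers; \<open>R u - 1\<close> undoes the
  shift used in array 1.\<close>

definition agreeing :: "(nat \<Rightarrow> nat \<Rightarrow> bool) \<Rightarrow> (nat \<Rightarrow> nat) \<Rightarrow> nat \<Rightarrow> nat \<Rightarrow> bool" where
  "agreeing A R u v \<longleftrightarrow> A (R u - 1) v \<or> A (R v - 1) u"

text \<open>Membership in \<open>hit\<close> on vertex numbers, with \<open>R u \<noteq> 0\<close>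
  standing for membership in \<open>far\<close>.\<close>

definition selected :: "(nat \<Rightarrow> nat \<Rightarrow> bool) \<Rightarrow> nat \<Rightarrow> (nat \<Rightarrow> nat) \<Rightarrow> nat \<Rightarrow> bool" where
  "selected A n R u \<longleftrightarrow> R u \<noteq> 0 \<and> (\<exists>v<n. R v \<noteq> 0 \<and> A u v \<and> agreeing A R u v) \<and>
    \<not> (\<exists>v<n. R v \<noteq> 0 \<and> A u v \<and> \<not> agreeing A R u v)"

definition classify_edges_at :: com where
  "classify_edges_at = for_loop 4
    (If (Cell 1 (Scalar 4))
      (If (Adjacent (Scalar 3) (Scalar 4))
        (If (Adjacent (Pred (Cell 1 (Scalar 3))) (Scalar 4)) (Store 2 (Scalar 3) (Lit 1))
          (If (Adjacent (Pred (Cell 1 (Scalar 4))) (Scalar 3)) (Store 2 (Scalar 3) (Lit 1))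
            (Store 3 (Scalar 3) (Lit 1))))
        Skip)
      Skip)"

lemma runs_classify_edges_at:
  assumes s: "scalar s 0 = n" "scalar s 3 = u" "cell s 1 = R" "cell s 2 u = 0" "cell s 3 u = 0"
  shows "runs A classify_edges_at s (6 + n * 37) (\<lambda>s'. scalar s' 0 = n \<and> scalar s' 3 = u \<and>
      (\<forall>a v. v \<noteq> u \<or> a \<noteq> 2 \<and> a \<noteq> 3 \<longrightarrow> cell s' a v = cell s a v) \<and>
      (cell s' 2 u \<noteq> 0 \<longleftrightarrow> (\<exists>v<n. R v \<noteq> 0 \<and> A u v \<and> agreeing A R u v)) \<and>
      (cell s' 3 u \<noteq> 0 \<longleftrightarrow> (\<exists>v<n. R v \<noteq> 0 \<and> A u v \<and> \<not> agreeing A R u v)))"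
proof -
  define I where "I w s' \<longleftrightarrow> scalar s' 3 = u \<and>
      (\<forall>a v. v \<noteq> u \<or> a \<noteq> 2 \<and> a \<noteq> 3 \<longrightarrow> cell s' a v = cell s a v) \<and>
      (cell s' 2 u \<noteq> 0 \<longleftrightarrow> (\<exists>v<w. R v \<noteq> 0 \<and> A u v \<and> agreeing A R u v)) \<and>
      (cell s' 3 u \<noteq> 0 \<longleftrightarrow> (\<exists>v<w. R v \<noteq> 0 \<and> A u v \<and> \<not> agreeing A R u v))" for w and s' :: state
  have counter: "I u (s'\<lparr>scalar := (scalar s')(4 := k)\<rparr>) \<longleftrightarrow> I u s'" for u s' k
    unfolding I_def by simp
  have less: "(\<exists>v<Suc w. P v) \<longleftrightarrow> P w \<or> (\<exists>v<w. P v)" for w P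
    using less_Suc_eq by auto
  show ?thesis
    unfolding classify_edges_at_def
  proof (rule runs_for[where n = n and b = 30 and I = I], goal_cases)
    case (1 v s')
    then have R: "cell s' 1 w = R w" for w using s(3) unfolding I_def by simp
    show ?case
      unfolding counter using 1 R
      by (intro runs_If runs_Store runs_Skip) (simp_all add: I_def less agreeing_def)
  next
    case 4
    show ?case using s unfolding counter I_def by simp
  next
    case (6 s')
    then show ?case unfolding I_def by blast
  qed (use s in auto)
qed

definition classify_edges :: com where
  "classify_edges = for_loop 3
    (If (Cell 1 (Scalar 3))
      (Seq classify_edges_at
        (If (Cell 3 (Scalar 3)) Skip (Store 0 (Scalar 3) (Cell 2 (Scalar 3)))))
      Skip)"

lemma runs_classify_edges:
  assumes s: "scalar s 0 = n" "cell s 1 = R" "\<And>a v. a \<noteq> 1 \<Longrightarrow> cell s a v = 0"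
  shows "runs A classify_edges s (6 + n * (36 + n * 37))
    (\<lambda>s'. \<forall>u<n. cell s' 0 u \<noteq> 0 \<longleftrightarrow> selected A n R u)"
proof -
  define I where "I u s' \<longleftrightarrow> cell s' 1 = R \<and> (\<forall>a v. a \<noteq> 1 \<and> u \<le> v \<longrightarrow> cell s' a v = 0) \<and>
      (\<forall>v<u. cell s' 0 v \<noteq> 0 \<longleftrightarrow> selected A n R v)" for u and s' :: state
  have counter: "I u (s'\<lparr>scalar := (scalar s')(3 := k)\<rparr>) \<longleftrightarrow> I u s'" for u s' k
    unfolding I_def by simp
  have step: "I (Suc u) s''"
    if I: "I u s'" and s'': "\<And>a v. v \<noteq> u \<or> a = 1 \<Longrightarrow> cell s'' a v = cell s' a v"
      "cell s'' 0 u \<noteq> 0 \<longleftrightarrow> selected A n R u" for u s' s''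
    unfolding I_def
  proof (intro conjI allI impI)
    show "cell s'' 1 = R" using s''(1) I unfolding I_def by auto
    show "cell s'' a v = 0" if "a \<noteq> 1 \<and> Suc u \<le> v" for a v
      using that I s''(1)[of v a] unfolding I_def by simp
    show "cell s'' 0 v \<noteq> 0 \<longleftrightarrow> selected A n R v" if "v < Suc u" for v
    proof (cases "v = u")
      case False
      then show ?thesis using that I s''(1)[of v 0] unfolding I_def by simp
    qed (use s''(2) in blast)
  qed
  show ?thesis
    unfolding classify_edges_def
  \<comment> \<open>The 23 consists of 3 for the outer test and a bound of 20 for the final
    conditional.\<close>
  proof (rule runs_for[where n = n and b = "23 + (6 + n * 37)" and I = I], goal_cases)
    case (1 u s')
    then have u: "cell s' 1 = R" "cell s' 0 u = 0" "cell s' 2 u = 0" "cell s' 3 u = 0"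
      unfolding I_def by auto
    show ?case
      unfolding counter
    proof (rule runs_If)
      assume "expr_val A s' (Cell 1 (Scalar 3)) \<noteq> 0"
      then have Ru: "R u \<noteq> 0" using 1 u by simp
      show "runs A (Seq classify_edges_at
          (If (Cell 3 (Scalar 3)) Skip (Store 0 (Scalar 3) (Cell 2 (Scalar 3)))))
        s' (23 + (6 + n * 37) - (1 + expr_cost (Cell 1 (Scalar 3))))
        (\<lambda>s''. scalar s'' 3 = u \<and> scalar s'' 0 = n \<and> I (Suc u) s'')"
      proof (rule runs_Seq[OF runs_conseq[OF runs_classify_edges_at[OF 1(4,3) u(1,3,4)] order_refl]])
        fix s1 :: state
        assume s1: "scalar s1 0 = n \<and> scalar s1 3 = u \<and>
          (\<forall>a v. v \<noteq> u \<or> a \<noteq> 2 \<and> a \<noteq> 3 \<longrightarrow> cell s1 a v = cell s' a v) \<and>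
          (cell s1 2 u \<noteq> 0 \<longleftrightarrow> (\<exists>v<n. R v \<noteq> 0 \<and> A u v \<and> agreeing A R u v)) \<and>
          (cell s1 3 u \<noteq> 0 \<longleftrightarrow> (\<exists>v<n. R v \<noteq> 0 \<and> A u v \<and> \<not> agreeing A R u v))"
        then have same: "cell s1 a v = cell s' a v" if "v \<noteq> u \<or> a = 1 \<or> a = 0" for a v
          using that by auto
        have sel: "selected A n R u \<longleftrightarrow> cell s1 2 u \<noteq> 0 \<and> cell s1 3 u = 0"
          using s1 Ru unfolding selected_def by blast
        show "runs A (If (Cell 3 (Scalar 3)) Skip (Store 0 (Scalar 3) (Cell 2 (Scalar 3)))) s1 20
          (\<lambda>s''. scalar s'' 3 = u \<and> scalar s'' 0 = n \<and> I (Suc u) s'')"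
          by (intro runs_If runs_Store runs_Skip conjI step[OF 1(2)])
            (use s1 same sel u in auto)
      qed simp
    next
      assume "expr_val A s' (Cell 1 (Scalar 3)) = 0"
      then have "R u = 0" using 1 u by simp
      then have "I (Suc u) s'" using u by (intro step[OF 1(2)]) (auto simp: selected_def)
      then show "runs A Skip s' (23 + (6 + n * 37) - (1 + expr_cost (Cell 1 (Scalar 3))))
        (\<lambda>s''. scalar s'' 3 = u \<and> scalar s'' 0 = n \<and> I (Suc u) s'')"
        using 1 by (intro runs_Skip) auto
    qed simp
  next
    case 4
    show ?case using s unfolding counter I_def by simp
  next
    case (6 s')
    then show ?case unfolding I_def by blast
  qed (use s in \<open>auto simp: algebra_simps\<close>)
qed

definition clique_program :: com where
  "clique_program = Seq find_neighbour (Seq find_common_neighbours classify_edges)"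

lemma runs_clique_program:
  assumes s: "s = input_state n i" and i: "\<exists>j<n. A i j"
  shows "runs A clique_program s (200 * n\<^sup>2) (\<lambda>s'. \<exists>y R. A i y \<and> (\<forall>u<n. common_ok A n y R u) \<and>
    (\<forall>u<n. cell s' 0 u \<noteq> 0 \<longleftrightarrow> selected A n R u))"
proof -
  let ?Q = "\<lambda>s'. \<exists>y R. A i y \<and> (\<forall>u<n. common_ok A n y R u) \<and>
    (\<forall>u<n. cell s' 0 u \<noteq> 0 \<longleftrightarrow> selected A n R u)"
  have 3: "runs A classify_edges s2 (6 + n * (36 + n * 37)) ?Q"
    if "scalar s2 0 = n" "\<forall>a v. cell s2 a v \<noteq> 0 \<longrightarrow> a = 1 \<and> v < n"
      "\<forall>u<n. common_ok A n y (cell s2 1) u" "A i y" for s2 :: state and y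
    by (rule runs_conseq[OF runs_classify_edges[OF that(1) refl] order_refl]) (use that in blast)+
  have 2: "runs A (Seq find_common_neighbours classify_edges) s1
      ((6 + n * (17 + n * 27)) + (6 + n * (36 + n * 37))) ?Q"
    if "scalar s1 0 = n" "cell s1 = cell s" "A i (scalar s1 2)" for s1 :: state
    by (rule runs_Seq[OF runs_conseq[OF runs_find_common_neighbours[OF that(1) refl] order_refl] order_refl])
      (use 3 that s in \<open>auto simp: input_state_def\<close>)
  have "runs A clique_program s ((6 + n * 20) +
      ((6 + n * (17 + n * 27)) + (6 + n * (36 + n * 37)))) ?Q"
    unfolding clique_program_def
    by (rule runs_Seq[OF runs_conseq[OF runs_find_neighbour[where n = n and i = i] order_refl] order_refl])
      (use 2 s i in \<open>auto simp: input_state_def\<close>)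
  \<comment> \<open>As \<open>n \<ge> 1\<close>, the sum is at most
    \<open>(18 + 73 + 64) * n\<^sup>2\<close>.\<close>
  moreover have "(6 + n * 20) + ((6 + n * (17 + n * 27)) + (6 + n * (36 + n * 37))) \<le> 200 * n\<^sup>2"
  proof -
    have "1 \<le> n" using i by auto
    then have "n \<le> n\<^sup>2" "1 \<le> n\<^sup>2" by (simp_all add: power2_eq_square)
    moreover have "(6 + n * 20) + ((6 + n * (17 + n * 27)) + (6 + n * (36 + n * 37))) =
        18 + 73 * n + 64 * n\<^sup>2"
      by (simp add: algebra_simps power2_eq_square)
    ultimately show ?thesis by linarith
  qed
  ultimately show ?thesis by (rule runs_conseq) blast
qed

section \<open>Graphs as records\<close>

lemma contains_graph_of_edges:
  assumes "length vs = k" "distinct vs" "set vs \<subseteq> verts G"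
    and "\<And>i j. i < k \<Longrightarrow> j < k \<Longrightarrow> {i, j} \<in> D \<longleftrightarrow> adj G (vs ! i) (vs ! j)"
  shows "contains G (graph_of_edges k D)"
  unfolding contains_def
proof (intro exI conjI)
  have "bij_betw ((!) vs) {..<k} (set vs)" using assms bij_betw_nth by blast
  moreover have "verts G \<inter> set vs = set vs" using assms(3) by blast
  ultimately show "isomorphic (graph_of_edges k D) (induced G (set vs))"
    using assms unfolding isomorphic_def graph_of_edges_def induced_def by (auto intro!: exI[of _ "(!) vs"])
qed (rule assms(3))

lemma prime_P6_bull_free_graph:
  assumes G: "simple_graph G" "prime_graph G" "free_of G P6" "free_of G bull"
  shows "prime_P6_bull_free (verts G) (adj G)"
proof
  show "finite (verts G)" using G(1) unfolding simple_graph_def by blast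
  have dom: "u \<in> verts G" and sym: "adj G v u" and irr: "u \<noteq> v" if "adj G u v" for u v
    using G(1) that unfolding simple_graph_def by blast+
  show "u \<in> verts G" "adj G v u" if "adj G u v" for u v using dom sym that by blast+
  show irrefl: "\<not> adj G u u" for u using irr by blast
  show "\<exists>w\<in>verts G - S. \<exists>s\<in>S. \<exists>t\<in>S. adj G w s \<and> \<not> adj G w t"
    if "S \<subseteq> verts G" "2 \<le> card S" "S \<noteq> verts G" for S
    using G(2) that unfolding prime_graph_def proper_homogeneous_def homogeneous_def by blast
  show False
    if "adj G a b" "adj G b c" "adj G c d" "adj G b e" "adj G c e"
      "\<not> adj G a c" "\<not> adj G a d" "\<not> adj G a e" "\<not> adj G b d" "\<not> adj G d e" for a b c d e
  proof -
    note E = that that(1-5)[THEN sym]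
    note N = that(6-10)[THEN contrapos_nn, OF sym]
    have "contains G bull"
      unfolding bull_def
    proof (rule contains_graph_of_edges[of "[a, b, c, d, e]"])
      show "distinct [a, b, c, d, e]" using E N irrefl by auto
      show "set [a, b, c, d, e] \<subseteq> verts G" using E dom by auto
      show "{i, j} \<in> {{0, 1}, {1, 2}, {2, 3}, {1, 4}, {2, 4}} \<longleftrightarrow>
          adj G ([a, b, c, d, e] ! i) ([a, b, c, d, e] ! j)" if "i < 5" "j < 5" for i j
      proof -
        have "i = 0 \<or> i = 1 \<or> i = 2 \<or> i = 3 \<or> i = 4" "j = 0 \<or> j = 1 \<or> j = 2 \<or> j = 3 \<or> j = 4"
          using that by linarith+
        then show ?thesis using E N irrefl by (elim disjE) (simp_all add: doubleton_eq_iff)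
      qed
    qed simp
    then show False using G(4) by blast
  qed
  show False
    if "adj G a b" "adj G b c" "adj G c d" "adj G d e" "adj G e f"
      "\<not> adj G a c" "\<not> adj G a d" "\<not> adj G a e" "\<not> adj G a f" "\<not> adj G b d" "\<not> adj G b e"
      "\<not> adj G b f" "\<not> adj G c e" "\<not> adj G c f" "\<not> adj G d f" for a b c d e f
  proof -
    note E = that that(1-5)[THEN sym]
    note N = that(6-15)[THEN contrapos_nn, OF sym]
    have "contains G P6"
      unfolding P6_def
    proof (rule contains_graph_of_edges[of "[a, b, c, d, e, f]"])
      show "distinct [a, b, c, d, e, f]" using E N irrefl by auto
      show "set [a, b, c, d, e, f] \<subseteq> verts G" using E dom by auto
      show "{i, j} \<in> {{0, 1}, {1, 2}, {2, 3}, {3, 4}, {4, 5}} \<longleftrightarrow>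
          adj G ([a, b, c, d, e, f] ! i) ([a, b, c, d, e, f] ! j)" if "i < 6" "j < 6" for i j
      proof -
        have "i = 0 \<or> i = 1 \<or> i = 2 \<or> i = 3 \<or> i = 4 \<or> i = 5"
          "j = 0 \<or> j = 1 \<or> j = 2 \<or> j = 3 \<or> j = 4 \<or> j = 5"
          using that by linarith+
        then show ?thesis using E N irrefl by (elim disjE) (simp_all add: doubleton_eq_iff)
      qed
    qed simp
    then show False using G(3) by blast
  qed
qed

lemma no_triangle_delete_verts:
  assumes "\<And>p q s. adj G p q \<Longrightarrow> adj G q s \<Longrightarrow> adj G p s \<Longrightarrow> p \<in> F \<or> q \<in> F \<or> s \<in> F"
  shows "free_of (delete_verts G F) triangle"
proof
  assume "contains (delete_verts G F) triangle"
  then obtain S f where "bij_betw f {..<3} (verts (induced (delete_verts G F) S))"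
    and f: "\<And>i j. i < 3 \<Longrightarrow> j < 3 \<Longrightarrow>
      {i, j} \<in> {{0, 1}, {1, 2}, {0, 2 :: nat}} \<longleftrightarrow> adj (induced (delete_verts G F) S) (f i) (f j)"
    unfolding contains_def isomorphic_def triangle_def graph_of_edges_def by auto
  then show False
    using assms[of "f 0" "f 1" "f 2"] f[of 0 1] f[of 1 2] f[of 0 2]
    unfolding induced_def delete_verts_def by auto
qed

lemma five_cycle_avoiding_cyc:
  assumes "prime_P6_bull_free (verts G) (adj G)" "x \<in> verts G" "five_cycle_avoiding G x"
  obtains c0 c1 c2 c3 c4 where "prime_P6_bull_free.cyc (adj G) c0 c1 c2 c3 c4"
    "prime_P6_bull_free.anti (verts G) (adj G) c0 c1 c2 c3 c4 x"
proof -
  interpret prime_P6_bull_free "verts G" "adj G" by (rule assms(1))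
  obtain C where C: "\<And>c. c \<in> C \<Longrightarrow> \<not> adj G x c" and "isomorphic C5 (induced G C)"
    using assms(3) unfolding five_cycle_avoiding_def by blast
  then obtain f where b: "bij_betw f {..<5} (verts G \<inter> C)"
    and f: "\<forall>i\<in>{..<5}. \<forall>j\<in>{..<5}. {i, j} \<in> {{0, 1}, {1, 2}, {2, 3}, {3, 4}, {4, 0 :: nat}} \<longleftrightarrow>
      f i \<in> C \<and> f j \<in> C \<and> adj G (f i) (f j)"
    unfolding isomorphic_def C5_def graph_of_edges_def induced_def by auto
  have fC: "f i \<in> C" if "i < 5" for i using b that unfolding bij_betw_def by auto
  have fE: "adj G (f i) (f j) \<longleftrightarrow> {i, j} \<in> {{0, 1}, {1, 2}, {2, 3}, {3, 4}, {4, 0 :: nat}}"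
    if "i < 5" "j < 5" for i j using f[rule_format, of i j] fC that by simp
  have "cyc (f 0) (f 1) (f 2) (f 3) (f 4)"
    unfolding cyc_def by (simp add: fE doubleton_eq_iff)
  moreover have "anti (f 0) (f 1) (f 2) (f 3) (f 4) x"
    unfolding anti_def using assms(2) C fC by simp
  ultimately show thesis by (rule that)
qed

abbreviation far :: "'a graph \<Rightarrow> 'a \<Rightarrow> 'a set" where
  "far G \<equiv> prime_P6_bull_free.far (verts G) (adj G)"

abbreviation hit :: "'a graph \<Rightarrow> 'a \<Rightarrow> ('a \<Rightarrow> 'a) \<Rightarrow> 'a set" where
  "hit G \<equiv> prime_P6_bull_free.hit (verts G) (adj G)"

section \<open>Solutions in graphs and correctness of the program\<close>

context
  fixes G :: "'a graph" and x :: 'a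
  assumes G: "simple_graph G" "prime_graph G" "free_of G P6" "free_of G bull"
    and x: "x \<in> verts G" "five_cycle_avoiding G x"
begin

interpretation prime_P6_bull_free "verts G" "adj G"
  by (rule prime_P6_bull_free_graph[OF G])

lemma neighbour_ex: "\<exists>y. adj G x y"
  using five_cycle_avoiding_cyc[OF prime_P6_bull_free_axioms x] anti_has_neighbour by metis

lemma hit_solution:
  assumes "adj G x y" "\<And>u. u \<in> far y \<Longrightarrow> adj G y (r u) \<and> adj G u (r u)"
  shows "clique G (hit y r)" "free_of (delete_verts G (hit y r)) triangle"
proof -
  obtain c0 c1 c2 c3 c4 where C: "cyc c0 c1 c2 c3 c4" "anti c0 c1 c2 c3 c4 x"
    by (rule five_cycle_avoiding_cyc[OF prime_P6_bull_free_axioms x])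
  note h = hit_clique_meets_triangles[OF C assms(1)]
  have "hit y r \<subseteq> verts G" unfolding hit_def far_def by blast
  moreover have "\<forall>u\<in>hit y r. \<forall>v\<in>hit y r. u \<noteq> v \<longrightarrow> adj G u v" by (rule h(1)) (rule assms(2))
  ultimately show "clique G (hit y r)" unfolding clique_def by blast
  have "p \<in> hit y r \<or> q \<in> hit y r \<or> s \<in> hit y r" if "adj G p q" "adj G q s" "adj G p s" for p q s
    by (rule h(2)[OF _ that]) (rule assms(2))
  then show "free_of (delete_verts G (hit y r)) triangle" by (rule no_triangle_delete_verts)
qed

lemma solution_ex: "\<exists>F. clique G F \<and> free_of (delete_verts G F) triangle"
proof -
  obtain y where "adj G x y" using neighbour_ex by blast
  moreover have "\<exists>r. \<forall>u\<in>far y. adj G y (r u) \<and> adj G u (r u)"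
    by (intro bchoice) (auto simp: far_def)
  ultimately show ?thesis using hit_solution by blast
qed

lemma clique_program_correct:
  assumes n: "n = card (verts G)" and num: "bij_betw num {..<n} (verts G)" and i: "i < n" "num i = x"
  shows "\<exists>t s. exec (adj_matrix G num) clique_program (input_state n i) t s \<and> t \<le> 200 * n\<^sup>2 \<and>
    clique G (output_set n num s) \<and> free_of (delete_verts G (output_set n num s)) triangle"
proof -
  let ?A = "adj_matrix G num"
  have A: "?A u v \<longleftrightarrow> u < n \<and> v < n \<and> adj G (num u) (num v)" for u v
    unfolding adj_matrix_def n by blast
  have num_V: "num u \<in> verts G" if "u < n" for u using num that unfolding bij_betw_def by blast
  have V_num: "\<exists>u<n. v = num u" if "v \<in> verts G" for v using num that unfolding bij_betw_def by blast
  have inj: "inj_on num {..<n}" using num unfolding bij_betw_def by blast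
  have V: "adj G u v \<Longrightarrow> v \<in> verts G" for u v using dom sym by blast
  have "\<exists>j<n. ?A i j" using neighbour_ex V V_num i A by metis
  from runs_clique_program[where A = ?A and n = n and i = i, OF refl this] obtain t s y R where
    run: "exec ?A clique_program (input_state n i) t s" "t \<le> 200 * n\<^sup>2" and y: "?A i y"
    and R: "\<forall>u<n. common_ok ?A n y R u"
    and s: "\<forall>u<n. cell s 0 u \<noteq> 0 \<longleftrightarrow> selected ?A n R u"
    unfolding runs_def by blast
  \<comment> \<open>Inverting the numbering turns array 1 into a choice of common neighbours on
    vertices.\<close>
  define r where "r v = num (R (the_inv_into {..<n} num v) - 1)" for v
  have r: "r (num u) = num (R u - 1)" if "u < n" for u
    unfolding r_def using the_inv_into_f_f[OF inj] that by simp
  have yn: "y < n" using y A by blast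
  have far: "R u \<noteq> 0 \<longleftrightarrow> num u \<in> far (num y)" if u: "u < n" for u
  proof -
    have "num u \<in> far (num y) \<longleftrightarrow> \<not> ?A y u \<and> (\<exists>p<n. ?A y p \<and> ?A u p)"
      unfolding far_def using A u yn num_V V V_num by (auto, metis+)
    then show ?thesis using R[rule_format, OF u] unfolding common_ok_def by (auto split: if_splits simp: A)
  qed
  have rR: "?A y (R u - 1) \<and> ?A u (R u - 1)" if "u < n" "R u \<noteq> 0" for u
    using R[rule_format, OF that(1)] that(2) unfolding common_ok_def by simp
  have bad: "agreeing ?A R u v \<longleftrightarrow> bad r (num u) (num v)" if "u < n" "v < n" "R u \<noteq> 0" "R v \<noteq> 0" for u v
    using rR[of u] rR[of v] that unfolding agreeing_def bad_def by (simp add: A r)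
  have ex: "(\<exists>v\<in>far (num y). P v) \<longleftrightarrow> (\<exists>v<n. R v \<noteq> 0 \<and> P (num v))" for P
  proof -
    have "v \<in> verts G" if "v \<in> far (num y)" for v using that unfolding far_def by blast
    then show ?thesis using far V_num by metis
  qed
  have sel: "selected ?A n R u \<longleftrightarrow> num u \<in> hit (num y) r" if u: "u < n" for u
  proof (cases "R u = 0")
    case True
    then show ?thesis using far[OF u] unfolding selected_def hit_def by blast
  next
    case False
    \<comment> \<open>The universal clause becomes a negated existential so that \<open>ex\<close>
      rewrites both parts into the form of \<open>selected\<close>.\<close>
    have "num u \<in> hit (num y) r \<longleftrightarrow> (\<exists>v\<in>far (num y). adj G (num u) v \<and> bad r (num u) v) \<and>
        \<not> (\<exists>v\<in>far (num y). adj G (num u) v \<and> \<not> bad r (num u) v)"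
      using far[OF u] False unfolding hit_def by blast
    then show ?thesis unfolding ex selected_def using False A u bad by blast
  qed
  have "output_set n num s = hit (num y) r"
  proof -
    have "v \<in> verts G" if "v \<in> hit (num y) r" for v using that unfolding hit_def far_def by blast
    then show ?thesis unfolding output_set_def using s sel V_num by blast
  qed
  moreover have "adj G x (num y)" using y A i by blast
  moreover have "adj G (num y) (r u) \<and> adj G u (r u)" if "u \<in> far (num y)" for u
  proof -
    have "u \<in> verts G" using that unfolding far_def by blast
    then obtain w where "w < n" "u = num w" using V_num by blast
    then show ?thesis using rR[of w] far[of w] that r A by simp
  qed
  ultimately show ?thesis using hit_solution[of "num y" r] run by metis
qed

end

theorem theorem3:
  shows "(\<forall>(G :: 'a graph) x.
      simple_graph G \<and> prime_graph G \<and> free_of G P6 \<and> free_of G bull \<and>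
      x \<in> verts G \<and> five_cycle_avoiding G x \<longrightarrow>
      (\<exists>F. clique G F \<and> free_of (delete_verts G F) triangle))
    \<and> (\<exists>prog c. \<forall>(G :: 'a graph) x n num i.
      simple_graph G \<and> prime_graph G \<and> free_of G P6 \<and> free_of G bull \<and>
      x \<in> verts G \<and> five_cycle_avoiding G x \<and>
      n = card (verts G) \<and> bij_betw num {..<n} (verts G) \<and> i < n \<and> num i = x \<longrightarrow>
      (\<exists>t s. exec (adj_matrix G num) prog (input_state n i) t s \<and> t \<le> c * n\<^sup>2 \<and>
        clique G (output_set n num s) \<and>
        free_of (delete_verts G (output_set n num s)) triangle))"
  apply (rule conjI)
   apply (intro allI impI, elim conjE, erule (5) solution_ex)
  apply (rule exI[of _ clique_program], rule exI[of _ 200])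
  apply (intro allI impI, elim conjE, erule (9) clique_program_correct)
  done

end
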